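(* Fix $\mathfrak{A}\in GL_n(F)^n$, a homogeneous polynomial $P$, $\mathbf{u}\in F^n$, $M\in R_n$ and $k\in\mathbb{Z}$. Then the series $$\Psi_s(\mathfrak{A})(P,\mathbf{u},M)=\sum_{x\in\mathbf{\Lambda}+\mathbf{u}}\psi(\mathfrak{A})(P,x)\,\Omega_s^k(x,M)$$ converges absolutely for $\mathrm{Re}(s)>1+\tfrac{k}{2}$.
   Context: $F\subset\mathbb{C}$ imaginary quadratic with ring of integers $\mathcal{O}_F$; $\mathbf{\Lambda}=\Lambda_1\times\dots\times\Lambda_n$ with each $\Lambda_i$ a lattice in $F$ with multiplier ring $\mathcal{O}_F$; vectors in $F^n$ are rows. $\langle x,v\rangle=\sum_ix_iv_i$. For $\sigma\in M_n(\mathbb{C})$ with columns $\sigma_j$: $f(\sigma)(x)=\det\sigma/\prod_j\langle x,\sigma_j\rangle$ if all $\langle x,\sigma_j\rangle\ne0$, else $0$; $f(\sigma)(P,x)=P(-\partial_{x_1},\dots,-\partial_{x_n})f(\sigma)(x)$ (and $0$ where some $\langle x,\sigma_j\rangle=0$). For $\mathfrak{A}=(A_1,\dots,A_n)$ with $A_{kj}$ the $j$-th column of $A_k$ and $x\ne0$, $j_k$ is the smallest index with $\langle x,A_{kj_k}\rangle\ne0$ and $\psi(\mathfrak{A})(P,x)=f(A_{1j_1},\dots,A_{nj_n})(P,x)$; $\psi(\mathfrak{A})(P,0)=0$. $R_n$: matrices $M\in GL_n(\mathbb{C})$ with $(i,j)$ entry $\rho_j(m_i)$ for a degree-$n$ extension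 $K/F$, distinct embeddings $\rho_j:K\to\mathbb{C}$ fixing $F$, $m_i\in K$; $M_i$ is its $i$-th column. $\Omega_s^k(x,M)=\prod_i\overline{xM_i}^{\,k}/|xM_i|^{2s}$. *)

theory Defs
  imports "HOL-Analysis.Analysis" "HOL-Computational_Algebra.Polynomial"
begin

(* Conventions: n is the dimension. Vectors in C^n are functions nat => complex,
   only indices < n are relevant. An n x n matrix is A :: nat => nat => complex,
   A i j = (i,j) entry, i,j < n. *)

definition imag_quad_field :: "complex set \<Rightarrow> bool" where
  "imag_quad_field F \<longleftrightarrow> (\<exists>d::int. d > 0 \<and>
     F = {of_rat a + of_rat b * (\<i> * of_real (sqrt (real_of_int d))) | a b. True})"

definition ring_of_integers :: "complex set \<Rightarrow> complex set" where
  "ring_of_integers F = {z \<in> F. algebraic_int z}"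

definition lattice_in :: "complex set \<Rightarrow> complex set \<Rightarrow> bool" where
  "lattice_in F L \<longleftrightarrow> (\<exists>w1 w2. w1 \<in> F \<and> w2 \<in> F \<and> w1 \<noteq> 0 \<and> Im (w2 / w1) \<noteq> 0 \<and>
     L = {of_int a * w1 + of_int b * w2 | a b. True})"

definition multiplier_ring :: "complex set \<Rightarrow> complex set" where
  "multiplier_ring L = {z. \<forall>l\<in>L. z * l \<in> L}"

definition inner_n :: "nat \<Rightarrow> (nat \<Rightarrow> complex) \<Rightarrow> (nat \<Rightarrow> complex) \<Rightarrow> complex" where
  "inner_n n x v = (\<Sum>i<n. x i * v i)"

definition det_n :: "nat \<Rightarrow> (nat \<Rightarrow> nat \<Rightarrow> complex) \<Rightarrow> complex" where
  "det_n n A = (\<Sum>p | p permutes {..<n}. of_int (sign p) * (\<Prod>i<n. A i (p i)))"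

definition col :: "(nat \<Rightarrow> nat \<Rightarrow> complex) \<Rightarrow> nat \<Rightarrow> (nat \<Rightarrow> complex)" where
  "col A j = (\<lambda>i. A i j)"

definition GL_n_over :: "nat \<Rightarrow> complex set \<Rightarrow> (nat \<Rightarrow> nat \<Rightarrow> complex) set" where
  "GL_n_over n F = {A. (\<forall>i<n. \<forall>j<n. A i j \<in> F) \<and> det_n n A \<noteq> 0}"

(* f(sigma)(x), sigma given by its columns c 0, ..., c (n-1) *)
definition f_cols :: "nat \<Rightarrow> (nat \<Rightarrow> nat \<Rightarrow> complex) \<Rightarrow> (nat \<Rightarrow> complex) \<Rightarrow> complex" where
  "f_cols n c x = (if (\<forall>j<n. inner_n n x (c j) \<noteq> 0)
      then det_n n (\<lambda>i j. c j i) / (\<Prod>j<n. inner_n n x (c j)) else 0)"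

definition pdiff :: "nat \<Rightarrow> ((nat \<Rightarrow> complex) \<Rightarrow> complex) \<Rightarrow> (nat \<Rightarrow> complex) \<Rightarrow> complex" where
  "pdiff i g x = deriv (\<lambda>t. g (x(i := t))) (x i)"

fun pdiffs :: "nat \<Rightarrow> (nat \<Rightarrow> nat) \<Rightarrow> ((nat \<Rightarrow> complex) \<Rightarrow> complex) \<Rightarrow> (nat \<Rightarrow> complex) \<Rightarrow> complex" where
  "pdiffs 0 \<alpha> g = g"
| "pdiffs (Suc m) \<alpha> g = (pdiff m ^^ \<alpha> m) (pdiffs m \<alpha> g)"

(* A polynomial in n variables with complex coefficients: coefficient function on
   multi-indices alpha (exponent of X_i is alpha i), finite support, only variables < n. *)
definition poly_n :: "nat \<Rightarrow> ((nat \<Rightarrow> nat) \<Rightarrow> complex) \<Rightarrow> bool" where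
  "poly_n n P \<longleftrightarrow> finite {\<alpha>. P \<alpha> \<noteq> 0} \<and> (\<forall>\<alpha>. P \<alpha> \<noteq> 0 \<longrightarrow> (\<forall>i\<ge>n. \<alpha> i = 0))"

definition homogeneous_poly_n :: "nat \<Rightarrow> ((nat \<Rightarrow> nat) \<Rightarrow> complex) \<Rightarrow> bool" where
  "homogeneous_poly_n n P \<longleftrightarrow> poly_n n P \<and>
     (\<exists>d. \<forall>\<alpha>. P \<alpha> \<noteq> 0 \<longrightarrow> (\<Sum>i<n. \<alpha> i) = d)"

(* f(sigma)(P,x) = P(-d_1,...,-d_n) f(sigma)(x), and 0 where some <x,sigma_j> = 0 *)
definition fP_cols :: "nat \<Rightarrow> (nat \<Rightarrow> nat \<Rightarrow> complex) \<Rightarrow> ((nat \<Rightarrow> nat) \<Rightarrow> complex)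
     \<Rightarrow> (nat \<Rightarrow> complex) \<Rightarrow> complex" where
  "fP_cols n c P x = (if (\<forall>j<n. inner_n n x (c j) \<noteq> 0)
      then (\<Sum>\<alpha>\<in>{\<alpha>. P \<alpha> \<noteq> 0}. P \<alpha> * (-1) ^ (\<Sum>i<n. \<alpha> i) * pdiffs n \<alpha> (f_cols n c) x)
      else 0)"

(* psi(A)(P,x); AA k is the matrix A_{k+1}, k < n *)
definition psi :: "nat \<Rightarrow> (nat \<Rightarrow> nat \<Rightarrow> nat \<Rightarrow> complex) \<Rightarrow> ((nat \<Rightarrow> nat) \<Rightarrow> complex)
     \<Rightarrow> (nat \<Rightarrow> complex) \<Rightarrow> complex" where
  "psi n AA P x = (if (\<forall>i<n. x i = 0) then 0
      else fP_cols n (\<lambda>k. col (AA k) (LEAST j. inner_n n x (col (AA k) j) \<noteq> 0)) P x)"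

definition subfield_C :: "complex set \<Rightarrow> bool" where
  "subfield_C K \<longleftrightarrow> 0 \<in> K \<and> 1 \<in> K \<and> (\<forall>a\<in>K. \<forall>b\<in>K. a + b \<in> K \<and> a * b \<in> K \<and> - a \<in> K) \<and>
     (\<forall>a\<in>K. a \<noteq> 0 \<longrightarrow> inverse a \<in> K)"

definition ext_degree_eq :: "complex set \<Rightarrow> complex set \<Rightarrow> nat \<Rightarrow> bool" where
  "ext_degree_eq K F n \<longleftrightarrow> (\<exists>b. (\<forall>i<n. b i \<in> K) \<and>
     (\<forall>z\<in>K. \<exists>!c. (\<forall>i<n. c i \<in> F) \<and> (\<forall>i\<ge>n. c i = 0) \<and> z = (\<Sum>i<n. c i * b i)))"

definition embedding_over :: "complex set \<Rightarrow> complex set \<Rightarrow> (complex \<Rightarrow> complex) \<Rightarrow> bool" where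
  "embedding_over K F \<rho> \<longleftrightarrow> (\<forall>a\<in>K. \<forall>b\<in>K. \<rho> (a + b) = \<rho> a + \<rho> b \<and> \<rho> (a * b) = \<rho> a * \<rho> b) \<and>
     \<rho> 1 = 1 \<and> (\<forall>a\<in>F. \<rho> a = a)"

definition R_n :: "nat \<Rightarrow> complex set \<Rightarrow> (nat \<Rightarrow> nat \<Rightarrow> complex) set" where
  "R_n n F = {M. det_n n M \<noteq> 0 \<and> (\<exists>K \<rho> m. subfield_C K \<and> F \<subseteq> K \<and> ext_degree_eq K F n \<and>
      (\<forall>j<n. embedding_over K F (\<rho> j)) \<and>
      (\<forall>j<n. \<forall>j'<n. j \<noteq> j' \<longrightarrow> (\<exists>a\<in>K. \<rho> j a \<noteq> \<rho> j' a)) \<and>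
      (\<forall>i<n. m i \<in> K) \<and> (\<forall>i<n. \<forall>j<n. M i j = \<rho> j (m i)))}"

definition Omega :: "nat \<Rightarrow> complex \<Rightarrow> int \<Rightarrow> (nat \<Rightarrow> complex) \<Rightarrow> (nat \<Rightarrow> nat \<Rightarrow> complex) \<Rightarrow> complex" where
  "Omega n s k x M = (\<Prod>i<n. cnj (inner_n n x (col M i)) powi k /
       (complex_of_real (norm (inner_n n x (col M i)))) powr (2 * s))"

definition shifted_lattice :: "nat \<Rightarrow> (nat \<Rightarrow> complex set) \<Rightarrow> (nat \<Rightarrow> complex) \<Rightarrow> (nat \<Rightarrow> complex) set" where
  "shifted_lattice n \<Lambda> u = {x. (\<forall>i<n. x i - u i \<in> \<Lambda> i) \<and> (\<forall>i\<ge>n. x i = 0)}"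

end

(* Write N(x) for the product of the |x M_i|, so that |Omega| = N(x)^(k - 2 Re s) with exponent
   below -2. On the lattice a nonzero linear form over F is bounded away from 0, so
   |psi(x)| <= C / |x|: the chosen columns are independent (or their determinant kills f), hence
   one of the forms is of size |x|, and differentiation only produces further bounded factors.
   Likewise N(x) >= c > 0 for x <> 0, since N(x) is the absolute value of a norm from K to F.
   The same bound applied to differences of lattice points shows that a box |x M_i| <= r_i with
   prod r_i >= c contains O(prod r_i^2) of them. In the dyadic decomposition |x M_i| ~ 2^(a_i)
   this count cancels N(x)^(-2), and 1/|x| is at most a constant times prod q^|a_i| for some
   q < 1, because N(x) >= c keeps every |a_i| of order 1 + log |x|. The sum over all a is then a
   product of geometric series; no unit theorem is needed. *)

theory Submission
  imports Defs "Jordan_Normal_Form.Determinant"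
begin

section \<open>Determinants on index functions; inverting a system of linear forms\<close>

section \<open>Determinants\<close>

text \<open>Bridge to the matrix library, which supplies multiplicativity of the determinant and the
  adjugate.\<close>

lemma det_n_eq_det: "det_n n A = Determinant.det (mat n n (\<lambda>(i,j). A i j))"
proof -
  have "(\<Prod>i<n. A i (p i)) = (\<Prod>i = 0..<n. mat n n (\<lambda>(i,j). A i j) $$ (i, p i))"
    if "p permutes {..<n}" for p
    using that by (auto simp: atLeast0LessThan permutes_in_image[of p "{..<n}", simplified] intro!: prod.cong)
  then show ?thesis
    unfolding det_n_def Determinant.det_def
    by (auto simp: atLeast0LessThan sign_def intro!: sum.cong)
qed

lemma det_n_cong:
  assumes "\<And>i j. i < n \<Longrightarrow> j < n \<Longrightarrow> A i j = B i j"
  shows "det_n n A = det_n n B"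
  unfolding det_n_def
  by (intro sum.cong refl arg_cong2[where f = "(*)"] prod.cong)
    (auto simp: assms permutes_in_image[of _ "{..<n}", simplified])

lemma det_n_mult:
  "det_n n (\<lambda>i j. \<Sum>k<n. A i k * B k j) = det_n n A * det_n n B"
proof -
  let ?A = "mat n n (\<lambda>(i,j). A i j)" and ?B = "mat n n (\<lambda>(i,j). B i j)"
  have "mat n n (\<lambda>(i,j). \<Sum>k<n. A i k * B k j) = ?A * ?B"
    by (rule eq_matI) (auto simp: scalar_prod_def atLeast0LessThan)
  then show ?thesis
    by (simp add: det_n_eq_det Determinant.det_mult[of _ n])
qed

text \<open>Each permutation meets every column exactly once, so every term of the expansion picks
  up the whole product of the \<open>d j\<close>.\<close>

lemma det_n_scale_columns:
  "det_n n (\<lambda>i j. A i j * d j) = (\<Prod>j<n. d j) * det_n n A"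
proof -
  have "(\<Prod>i<n. A i (p i) * d (p i)) = (\<Prod>j<n. d j) * (\<Prod>i<n. A i (p i))"
    if "p permutes {..<n}" for p
    using prod.permute[OF that, of d] by (simp add: prod.distrib o_def)
  then show ?thesis
    unfolding det_n_def sum_distrib_left by (intro sum.cong) (auto simp: algebra_simps)
qed

lemma det_n_nonzero_imp_right_inverse:
  assumes "det_n n A \<noteq> 0"
  obtains B where "\<And>i j. i < n \<Longrightarrow> j < n \<Longrightarrow> (\<Sum>k<n. A i k * B k j) = (if i = j then 1 else 0)"
proof -
  let ?A = "mat n n (\<lambda>(i,j). A i j)"
  define d where "d = Determinant.det ?A"
  define C where "C = adj_mat ?A"
  have d: "d \<noteq> 0" using assms by (simp add: d_def det_n_eq_det)
  have C: "C \<in> carrier_mat n n" "?A * C = d \<cdot>\<^sub>m 1\<^sub>m n"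
    using adj_mat[of ?A n] by (auto simp: C_def d_def)
  have "(\<Sum>k<n. A i k * (C $$ (k, j) / d)) = (if i = j then 1 else 0)" if "i < n" "j < n" for i j
  proof -
    have "(?A * C) $$ (i, j) = (\<Sum>k<n. A i k * C $$ (k, j))"
      using C(1) that by (auto simp: scalar_prod_def atLeast0LessThan)
    moreover have "(?A * C) $$ (i, j) = (if i = j then d else 0)"
      using that by (simp add: C(2))
    moreover have "(\<Sum>k<n. A i k * (C $$ (k, j) / d)) = (\<Sum>k<n. A i k * C $$ (k, j)) / d"
      by (simp add: sum_divide_distrib)
    ultimately show ?thesis using d by (metis div_0 divide_self)
  qed
  then show ?thesis by (rule that)
qed

text \<open>A right inverse \<open>B\<close> of \<open>A\<close> recovers \<open>x\<close> from the
  values of the column forms, so some form is as large as \<open>x\<close> up to a constant. The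
  summand 1 in \<open>C\<close> makes it positive.\<close>

lemma sum_norm_le_inner_columns:
  assumes "det_n n A \<noteq> 0"
  obtains C where "C > 0" "\<And>x. (\<Sum>i<n. norm (x i)) \<le> C * (\<Sum>j<n. norm (inner_n n x (Defs.col A j)))"
proof -
  obtain B where B: "\<And>i j. i < n \<Longrightarrow> j < n \<Longrightarrow> (\<Sum>k<n. A i k * B k j) = (if i = j then 1 else 0)"
    using det_n_nonzero_imp_right_inverse[OF assms] by blast
  define C where "C = 1 + (\<Sum>i<n. \<Sum>j<n. norm (B j i))"
  have C: "C > 0" unfolding C_def by (intro add_pos_nonneg sum_nonneg) auto
  have "(\<Sum>i<n. norm (x i)) \<le> C * (\<Sum>j<n. norm (inner_n n x (Defs.col A j)))" for x
  proof -
    let ?L = "\<lambda>j. inner_n n x (Defs.col A j)"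
    have x: "x i = (\<Sum>j<n. ?L j * B j i)" if "i < n" for i
    proof -
      have "(\<Sum>j<n. ?L j * B j i) = (\<Sum>k<n. x k * (\<Sum>j<n. A k j * B j i))"
        unfolding inner_n_def Defs.col_def sum_distrib_left sum_distrib_right
        by (subst sum.swap) (simp add: algebra_simps)
      also have "\<dots> = (\<Sum>k<n. if k = i then x k else 0)"
        using B that by (intro sum.cong) auto
      also have "\<dots> = x i" using that by simp
      finally show ?thesis by simp
    qed
    have "(\<Sum>i<n. norm (x i)) \<le> (\<Sum>i<n. \<Sum>j<n. norm (?L j) * norm (B j i))"
      by (rule sum_mono, subst x, simp) (rule order_trans[OF norm_sum], simp add: norm_mult)
    also have "\<dots> \<le> (\<Sum>i<n. \<Sum>j<n. (\<Sum>j<n. norm (?L j)) * norm (B j i))"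
      by (intro sum_mono mult_right_mono member_le_sum) auto
    also have "\<dots> = (\<Sum>j<n. norm (?L j)) * (\<Sum>i<n. \<Sum>j<n. norm (B j i))"
      by (simp add: sum_distrib_left)
    also have "\<dots> \<le> (\<Sum>j<n. norm (?L j)) * C"
      unfolding C_def by (intro mult_left_mono sum_nonneg) auto
    finally show ?thesis by (simp add: mult.commute)
  qed
  with C show ?thesis by (rule that)
qed

lemma exists_inner_column_nonzero:
  assumes "det_n n A \<noteq> 0" "i < n" "x i \<noteq> 0"
  shows "\<exists>j<n. inner_n n x (Defs.col A j) \<noteq> 0"
proof (rule ccontr)
  assume "\<not> ?thesis"
  moreover obtain C where "(\<Sum>i<n. norm (x i)) \<le> C * (\<Sum>j<n. norm (inner_n n x (Defs.col A j)))"
    using sum_norm_le_inner_columns[OF assms(1)] by metis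
  ultimately have "(\<Sum>i<n. norm (x i)) \<le> 0" by simp
  moreover have "norm (x i) \<le> (\<Sum>i<n. norm (x i))"
    using assms by (intro member_le_sum) auto
  ultimately show False using assms(3) by (meson order_trans norm_le_zero_iff)
qed

section \<open>The discrete order Z[sqrt(-d)] inside F\<close>

section \<open>Discreteness and common denominators\<close>

text \<open>The order Z[sqrt(-d)], in general smaller than the ring of integers. It serves as a
  discrete ring: any finite subset of F is scaled into it by one positive integer.\<close>

definition quad_order :: "int \<Rightarrow> complex set" where
  "quad_order d = {of_int a + of_int b * (\<i> * of_real (sqrt (real_of_int d))) | a b. True}"

context
  fixes d :: int
  assumes d: "d > 0"
begin

lemma of_int_in_quad_order: "of_int a \<in> quad_order d"
  unfolding quad_order_def by (rule CollectI, rule exI[of _ a], rule exI[of _ 0]) simp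

lemma quad_order_add: 
  assumes "x \<in> quad_order d" "y \<in> quad_order d" shows "x + y \<in> quad_order d"
proof -
  obtain a b a' b' where "x = of_int a + of_int b * (\<i> * of_real (sqrt (real_of_int d)))"
    "y = of_int a' + of_int b' * (\<i> * of_real (sqrt (real_of_int d)))"
    using assms unfolding quad_order_def by blast
  then have "x + y = of_int (a + a') + of_int (b + b') * (\<i> * of_real (sqrt (real_of_int d)))"
    by (simp add: algebra_simps)
  then show ?thesis unfolding quad_order_def by blast
qed

lemma quad_order_mult: 
  assumes "x \<in> quad_order d" "y \<in> quad_order d" shows "x * y \<in> quad_order d"
proof -
  obtain a b a' b' where xy: "x = of_int a + of_int b * (\<i> * of_real (sqrt (real_of_int d)))"
    "y = of_int a' + of_int b' * (\<i> * of_real (sqrt (real_of_int d)))"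
    using assms unfolding quad_order_def by blast
  define w where "w = \<i> * complex_of_real (sqrt (real_of_int d))"
  have w: "w * w = - of_int d"
    unfolding w_def using d by (simp add: algebra_simps flip: of_real_mult)
  have "x * y = of_int a * of_int a' + (of_int a * of_int b' + of_int a' * of_int b) * w + of_int b * of_int b' * (w * w)"
    unfolding xy w_def[symmetric] by (simp add: algebra_simps)
  then have "x * y = of_int (a * a' - d * (b * b')) + of_int (a * b' + a' * b) * w"
    unfolding w by (simp add: algebra_simps)
  then show ?thesis unfolding quad_order_def w_def by blast
qed

lemma quad_order_sum: "(\<And>i. i \<in> I \<Longrightarrow> f i \<in> quad_order d) \<Longrightarrow> sum f I \<in> quad_order d"
  using of_int_in_quad_order[of 0] by (induction I rule: infinite_finite_induct) (auto intro: quad_order_add)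

lemma quad_order_prod: "(\<And>i. i \<in> I \<Longrightarrow> f i \<in> quad_order d) \<Longrightarrow> prod f I \<in> quad_order d"
  using of_int_in_quad_order[of 1] by (induction I rule: infinite_finite_induct) (auto intro: quad_order_mult)

lemma quad_order_det_n:
  assumes "\<And>i j. i < n \<Longrightarrow> j < n \<Longrightarrow> A i j \<in> quad_order d"
  shows "det_n n A \<in> quad_order d"
  unfolding det_n_def
  by (intro quad_order_sum quad_order_mult of_int_in_quad_order quad_order_prod assms)
    (auto simp: permutes_in_image[of _ "{..<n}", simplified])

text \<open>The squared absolute value is the integer a^2 + d b^2. All lower bounds for linear forms
  and their products come from this.\<close>

lemma norm_quad_order_ge_1:
  assumes "x \<in> quad_order d" "x \<noteq> 0" shows "norm x \<ge> 1"
proof -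
  obtain a b where x: "x = of_int a + of_int b * (\<i> * of_real (sqrt (real_of_int d)))"
    using assms unfolding quad_order_def by blast
  have "(norm x)\<^sup>2 = (real_of_int a)\<^sup>2 + (real_of_int b)\<^sup>2 * real_of_int d"
    unfolding cmod_power2 x using d by (simp add: power_mult_distrib)
  also have "\<dots> = of_int (a\<^sup>2 + b\<^sup>2 * d)" by simp
  finally have n: "(norm x)\<^sup>2 = of_int (a\<^sup>2 + b\<^sup>2 * d)" .
  have "a\<^sup>2 + b\<^sup>2 * d > 0"
    using n assms(2) by (metis of_int_0_less_iff zero_less_norm_iff zero_less_power)
  then have "(norm x)\<^sup>2 \<ge> 1" unfolding n by linarith
  then show ?thesis using abs_le_square_iff[of 1 "norm x"] by simp
qed

lemma common_denominator:
  fixes F defines "F \<equiv> {of_rat a + of_rat b * (\<i> * of_real (sqrt (real_of_int d))) | a b. True}"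
  assumes "finite Z" "Z \<subseteq> F"
  shows "\<exists>D>0. \<forall>z\<in>Z. of_int D * z \<in> quad_order d"
  using assms(2,3)
proof (induction Z rule: finite_induct)
  case empty
  show ?case by (intro exI[of _ 1]) auto
next
  case (insert z Z)
  then obtain D where D: "D > 0" "\<forall>z\<in>Z. of_int D * z \<in> quad_order d" by auto
  obtain a b where z: "z = of_rat a + of_rat b * (\<i> * of_real (sqrt (real_of_int d)))"
    using insert unfolding F_def by blast
  obtain a1 a2 b1 b2 where q: "quotient_of a = (a1, a2)" "quotient_of b = (b1, b2)"
    by (metis surj_pair)
  have ab: "a = of_int a1 / of_int a2" "b = of_int b1 / of_int b2" "a2 > 0" "b2 > 0"
    using q by (auto simp: quotient_of_div quotient_of_denom_pos)
  have "of_int (a2 * b2) * z = of_int (a1 * b2) + of_int (b1 * a2) * (\<i> * of_real (sqrt (real_of_int d)))"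
    unfolding z ab using ab(3,4) by (simp add: of_rat_divide field_simps)
  then have z': "of_int (a2 * b2) * z \<in> quad_order d" unfolding quad_order_def by blast
  show ?case
  proof (intro exI[of _ "D * (a2 * b2)"] conjI ballI)
    show "D * (a2 * b2) > 0" using D ab by simp
    fix y assume "y \<in> insert z Z"
    then consider "y = z" | "y \<in> Z" by blast
    then show "of_int (D * (a2 * b2)) * y \<in> quad_order d"
    proof cases
      case 1
      then show ?thesis using quad_order_mult[OF of_int_in_quad_order[of D] z'] by (simp add: mult.assoc)
    next
      case 2
      then show ?thesis using quad_order_mult[OF of_int_in_quad_order[of "a2*b2"] D(2)[rule_format, OF 2]] 
        by (simp add: algebra_simps)
    qed
  qed
qed

end

section \<open>Derivatives of f(sigma) as multiples of det(sigma) over the product of the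
  forms\<close>

section \<open>Partial derivatives of products of reciprocal linear forms\<close>

text \<open>Where all forms are nonzero, this algebra is closed under partial derivatives, and
  so are its multiples of the product of all reciprocals.\<close>

inductive recip_alg :: "nat \<Rightarrow> (nat \<Rightarrow> nat \<Rightarrow> complex) \<Rightarrow> ((nat \<Rightarrow> complex) \<Rightarrow> complex) \<Rightarrow> bool"
  for n c where
  const: "recip_alg n c (\<lambda>x. a)"
| recip: "j < n \<Longrightarrow> recip_alg n c (\<lambda>x. inverse (inner_n n x (c j)))"
| add: "recip_alg n c g \<Longrightarrow> recip_alg n c h \<Longrightarrow> recip_alg n c (\<lambda>x. g x + h x)"
| mult: "recip_alg n c g \<Longrightarrow> recip_alg n c h \<Longrightarrow> recip_alg n c (\<lambda>x. g x * h x)"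

text \<open>Along one coordinate the form is affine in \<open>t\<close>; for
  \<open>i \<ge> n\<close> it is constant, hence the case distinction.\<close>

lemma inner_n_fun_upd:
  "inner_n n (x(i := t)) v = inner_n n x v + (if i < n then v i else 0) * (t - x i)"
proof -
  have "inner_n n (x(i := t)) v = (\<Sum>k<n. x k * v k + (if k = i then v i * (t - x i) else 0))"
    unfolding inner_n_def by (intro sum.cong) (auto simp: algebra_simps)
  also have "\<dots> = inner_n n x v + (if i < n then v i else 0) * (t - x i)"
    by (simp add: sum.distrib inner_n_def)
  finally show ?thesis .
qed

lemma has_field_derivative_inverse_inner_n:
  assumes "inner_n n x v \<noteq> 0"
  shows "((\<lambda>t. inverse (inner_n n (x(i := t)) v)) has_field_derivative
    - (if i < n then v i else 0) * (inverse (inner_n n x v) * inverse (inner_n n x v))) (at (x i))"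
  unfolding inner_n_fun_upd using assms
  by (auto intro!: derivative_eq_intros simp: power2_eq_square field_simps)

text \<open>The derivative of a generator is a constant times its square, again in the algebra; sums
  and products follow from the usual rules. The derivative relation is carried along, rather than a
  value of \<open>deriv\<close>, so that differentiability stays available.\<close>

lemma recip_alg_deriv:
  assumes "recip_alg n c g"
  shows "\<exists>h. recip_alg n c h \<and> (\<forall>x. (\<forall>j<n. inner_n n x (c j) \<noteq> 0) \<longrightarrow>
    ((\<lambda>t. g (x(i := t))) has_field_derivative h x) (at (x i)))"
  using assms
proof induction
  case (const a)
  show ?case by (rule exI[of _ "\<lambda>x. 0"]) (auto intro: recip_alg.intros)
next
  case (recip j)
  then show ?case
    by (intro exI[of _ "\<lambda>x. - (if i < n then c j i else 0) * (inverse (inner_n n x (c j)) * inverse (inner_n n x (c j)))"]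
        conjI recip_alg.intros allI impI has_field_derivative_inverse_inner_n) auto
next
  case (add g h)
  then obtain g' h' where "recip_alg n c g'" "recip_alg n c h'"
    "\<And>x. (\<forall>j<n. inner_n n x (c j) \<noteq> 0) \<Longrightarrow> ((\<lambda>t. g (x(i := t))) has_field_derivative g' x) (at (x i))"
    "\<And>x. (\<forall>j<n. inner_n n x (c j) \<noteq> 0) \<Longrightarrow> ((\<lambda>t. h (x(i := t))) has_field_derivative h' x) (at (x i))"
    by blast
  then show ?case
    by (intro exI[of _ "\<lambda>x. g' x + h' x"]) (auto intro!: recip_alg.add DERIV_add simp del: fun_upd_apply)
next
  case (mult g h)
  then obtain g' h' where "recip_alg n c g'" "recip_alg n c h'"
    "\<And>x. (\<forall>j<n. inner_n n x (c j) \<noteq> 0) \<Longrightarrow> ((\<lambda>t. g (x(i := t))) has_field_derivative g' x) (at (x i))"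
    "\<And>x. (\<forall>j<n. inner_n n x (c j) \<noteq> 0) \<Longrightarrow> ((\<lambda>t. h (x(i := t))) has_field_derivative h' x) (at (x i))"
    by blast
  note h = this
  have "((\<lambda>t. g (x(i := t)) * h (x(i := t))) has_field_derivative g' x * h x + h' x * g x) (at (x i))"
    if "\<forall>j<n. inner_n n x (c j) \<noteq> 0" for x
    using DERIV_mult[OF h(3,4)[OF that]] by simp
  with mult.hyps h(1,2) show ?case
    by (intro exI[of _ "\<lambda>x. g' x * h x + h' x * g x"]) (auto intro!: recip_alg.mult recip_alg.add simp del: fun_upd_apply)
qed

text \<open>Logarithmic differentiation: for \<open>i < n\<close> the cofactor \<open>g\<close> is
  minus the sum of \<open>c j i / inner_n n x (c j)\<close> over \<open>j < m\<close>. The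
  truncation at \<open>m\<close> serves the induction.\<close>

lemma prod_inverse_inner_n_deriv:
  assumes "m \<le> n"
  shows "\<exists>g. recip_alg n c g \<and> (\<forall>x. (\<forall>j<n. inner_n n x (c j) \<noteq> 0) \<longrightarrow>
    ((\<lambda>t. \<Prod>j<m. inverse (inner_n n (x(i := t)) (c j))) has_field_derivative
      (\<Prod>j<m. inverse (inner_n n x (c j))) * g x) (at (x i)))"
  using assms
proof (induction m)
  case 0
  show ?case by (rule exI[of _ "\<lambda>x. 0"]) (auto intro: recip_alg.intros)
next
  case (Suc m)
  then obtain g where g: "recip_alg n c g"
    "\<And>x. (\<forall>j<n. inner_n n x (c j) \<noteq> 0) \<Longrightarrow>
    ((\<lambda>t. \<Prod>j<m. inverse (inner_n n (x(i := t)) (c j))) has_field_derivative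
      (\<Prod>j<m. inverse (inner_n n x (c j))) * g x) (at (x i))" by (auto simp del: fun_upd_apply)
  define h where "h = (\<lambda>x. g x + (- (if i < n then c m i else 0)) * inverse (inner_n n x (c m)))"
  show ?case
  proof (intro exI[of _ h] conjI allI impI)
    show "recip_alg n c h" unfolding h_def using g(1) Suc by (intro recip_alg.intros) auto
    fix x assume x: "\<forall>j<n. inner_n n x (c j) \<noteq> 0"
    with Suc have "inner_n n x (c m) \<noteq> 0" by auto
    from DERIV_mult[OF g(2)[OF x] has_field_derivative_inverse_inner_n[OF this]]
    show "((\<lambda>t. \<Prod>j<Suc m. inverse (inner_n n (x(i := t)) (c j))) has_field_derivative
      (\<Prod>j<Suc m. inverse (inner_n n x (c j))) * h x) (at (x i))"
      by (simp add: h_def algebra_simps)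
  qed
qed

text \<open>The formula for \<open>f\<close> is given only where all forms are nonzero. This
  suffices, because the condition persists for \<open>t\<close> near \<open>x i\<close> and
  \<open>deriv\<close> depends only on nearby values.\<close>

lemma pdiff_prod_inverse_inner_n:
  assumes "recip_alg n c g"
    and f: "\<And>x. (\<forall>j<n. inner_n n x (c j) \<noteq> 0) \<Longrightarrow> f x = K * (\<Prod>j<n. inverse (inner_n n x (c j))) * g x"
  shows "\<exists>h. recip_alg n c h \<and> (\<forall>x. (\<forall>j<n. inner_n n x (c j) \<noteq> 0) \<longrightarrow>
    pdiff i f x = K * (\<Prod>j<n. inverse (inner_n n x (c j))) * h x)"
proof -
  obtain g' where g': "recip_alg n c g'" "\<And>x. (\<forall>j<n. inner_n n x (c j) \<noteq> 0) \<Longrightarrow>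
    ((\<lambda>t. g (x(i := t))) has_field_derivative g' x) (at (x i))"
    using recip_alg_deriv[OF assms(1)] by blast
  obtain q where q: "recip_alg n c q" "\<And>x. (\<forall>j<n. inner_n n x (c j) \<noteq> 0) \<Longrightarrow>
    ((\<lambda>t. \<Prod>j<n. inverse (inner_n n (x(i := t)) (c j))) has_field_derivative
      (\<Prod>j<n. inverse (inner_n n x (c j))) * q x) (at (x i))"
    using prod_inverse_inner_n_deriv[of n n c i] by blast
  have "pdiff i f x = K * (\<Prod>j<n. inverse (inner_n n x (c j))) * (q x * g x + g' x)"
    if x: "\<forall>j<n. inner_n n x (c j) \<noteq> 0" for x
  proof -
    have "\<forall>\<^sub>F t in nhds (x i). inner_n n (x(i := t)) (c j) \<noteq> 0" if "j < n" for j
    proof -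
      have "((\<lambda>t. inner_n n (x(i := t)) (c j)) \<longlongrightarrow> inner_n n (x(i := x i)) (c j)) (nhds (x i))"
        unfolding inner_n_fun_upd by (intro tendsto_intros filterlim_ident)
      from tendsto_imp_eventually_ne[OF this, of 0] x that show ?thesis by simp
    qed
    then have "\<forall>\<^sub>F t in nhds (x i). \<forall>j\<in>{..<n}. inner_n n (x(i := t)) (c j) \<noteq> 0"
      by (intro eventually_ball_finite) auto
    then have "\<forall>\<^sub>F t in nhds (x i). f (x(i := t)) =
        K * ((\<Prod>j<n. inverse (inner_n n (x(i := t)) (c j))) * g (x(i := t)))"
      by eventually_elim (simp add: f)
    then have "pdiff i f x = deriv (\<lambda>t. K * ((\<Prod>j<n. inverse (inner_n n (x(i := t)) (c j))) * g (x(i := t)))) (x i)"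
      unfolding pdiff_def by (intro deriv_cong_ev) auto
    also have "\<dots> = K * ((\<Prod>j<n. inverse (inner_n n x (c j))) * q x * g x +
        g' x * (\<Prod>j<n. inverse (inner_n n x (c j))))"
      using DERIV_cmult[OF DERIV_mult[OF q(2)[OF x] g'(2)[OF x]], of K]
      by (intro DERIV_imp_deriv) simp
    finally show ?thesis by (simp add: algebra_simps)
  qed
  then show ?thesis
    using assms(1) g'(1) q(1)
    by (intro exI[of _ "\<lambda>x. q x * g x + g' x"]) (auto intro!: recip_alg.intros)
qed

lemma pdiff_funpow_prod_inverse_inner_n:
  assumes "recip_alg n c g"
    and "\<And>x. (\<forall>j<n. inner_n n x (c j) \<noteq> 0) \<Longrightarrow> f x = K * (\<Prod>j<n. inverse (inner_n n x (c j))) * g x"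
  shows "\<exists>h. recip_alg n c h \<and> (\<forall>x. (\<forall>j<n. inner_n n x (c j) \<noteq> 0) \<longrightarrow>
    (pdiff i ^^ m) f x = K * (\<Prod>j<n. inverse (inner_n n x (c j))) * h x)"
proof (induction m)
  case 0
  show ?case using assms by auto
next
  case (Suc m)
  then show ?case using pdiff_prod_inverse_inner_n[of n c _ "(pdiff i ^^ m) f" K i] by auto
qed

text \<open>Every iterated derivative keeps the determinant over the product of the forms as a
  factor. The product gives the decay, and a zero determinant makes all derivatives vanish on this
  set.\<close>

lemma pdiffs_f_cols:
  "\<exists>h. recip_alg n c h \<and> (\<forall>x. (\<forall>j<n. inner_n n x (c j) \<noteq> 0) \<longrightarrow>
    pdiffs m \<alpha> (f_cols n c) x = det_n n (\<lambda>i j. c j i) * (\<Prod>j<n. inverse (inner_n n x (c j))) * h x)"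
proof (induction m)
  case 0
  show ?case
    by (intro exI[of _ "\<lambda>x. 1"])
      (auto intro: recip_alg.intros simp: f_cols_def divide_inverse prod_inversef[symmetric] o_def)
next
  case (Suc m)
  then show ?case 
    using pdiff_funpow_prod_inverse_inner_n[of n c _ "pdiffs m \<alpha> (f_cols n c)"] by auto
qed

text \<open>Each generator is at most \<open>1 / \<delta>\<close> in absolute value, and boundedness
  passes to sums and products.\<close>

lemma recip_alg_bounded:
  assumes "recip_alg n c g" "\<delta> > 0"
  shows "\<exists>C\<ge>0. \<forall>x. (\<forall>j<n. norm (inner_n n x (c j)) \<ge> \<delta>) \<longrightarrow> norm (g x) \<le> C"
  using assms(1)
proof induction
  case (const a)
  show ?case by (intro exI[of _ "norm a"]) auto
next
  case (recip j)
  with assms(2) show ?case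
    by (intro exI[of _ "inverse \<delta>"]) (auto simp: norm_inverse intro!: le_imp_inverse_le)
next
  case (add g h)
  then obtain C C' where "C \<ge> 0" "C' \<ge> 0"
    "\<And>x. (\<forall>j<n. norm (inner_n n x (c j)) \<ge> \<delta>) \<Longrightarrow> norm (g x) \<le> C"
    "\<And>x. (\<forall>j<n. norm (inner_n n x (c j)) \<ge> \<delta>) \<Longrightarrow> norm (h x) \<le> C'" by blast
  then show ?case by (intro exI[of _ "C + C'"]) (auto intro!: norm_triangle_mono)
next
  case (mult g h)
  then obtain C C' where "C \<ge> 0" "C' \<ge> 0"
    "\<And>x. (\<forall>j<n. norm (inner_n n x (c j)) \<ge> \<delta>) \<Longrightarrow> norm (g x) \<le> C"
    "\<And>x. (\<forall>j<n. norm (inner_n n x (c j)) \<ge> \<delta>) \<Longrightarrow> norm (h x) \<le> C'" by blast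
  then show ?case by (intro exI[of _ "C * C'"]) (auto simp: norm_mult intro!: mult_mono)
qed

lemma norm_fP_cols_le:
  assumes "\<delta> > 0"
  shows "\<exists>C\<ge>0. \<forall>x. (\<forall>j<n. norm (inner_n n x (c j)) \<ge> \<delta>) \<longrightarrow>
    norm (fP_cols n c P x) \<le> C * norm (det_n n (\<lambda>i j. c j i)) * (\<Prod>j<n. inverse (norm (inner_n n x (c j))))"
proof -
  define S where "S = {\<alpha>. P \<alpha> \<noteq> 0}"
  define Q where "Q = (\<lambda>x. det_n n (\<lambda>i j. c j i) * (\<Prod>j<n. inverse (inner_n n x (c j))))"
  have "\<exists>C\<ge>0. \<forall>x. (\<forall>j<n. norm (inner_n n x (c j)) \<ge> \<delta>) \<longrightarrow>
     norm (pdiffs n \<alpha> (f_cols n c) x) \<le> C * norm (Q x)" for \<alpha>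
  proof -
    obtain h where h: "recip_alg n c h" "\<And>x. (\<forall>j<n. inner_n n x (c j) \<noteq> 0) \<Longrightarrow>
       pdiffs n \<alpha> (f_cols n c) x = Q x * h x"
      unfolding Q_def using pdiffs_f_cols[of n c n \<alpha>] by blast
    obtain C where C: "C \<ge> 0" "\<And>x. (\<forall>j<n. norm (inner_n n x (c j)) \<ge> \<delta>) \<Longrightarrow> norm (h x) \<le> C"
      using recip_alg_bounded[OF h(1) assms] by blast
    have "norm (pdiffs n \<alpha> (f_cols n c) x) \<le> C * norm (Q x)"
      if x: "\<forall>j<n. norm (inner_n n x (c j)) \<ge> \<delta>" for x
    proof -
      have "\<forall>j<n. inner_n n x (c j) \<noteq> 0" using x assms by fastforce
      then show ?thesis using h(2) mult_right_mono[OF C(2)[OF x], of "norm (Q x)"]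
        by (simp add: norm_mult mult.commute)
    qed
    with C(1) show ?thesis by blast
  qed
  then obtain C where C: "\<And>\<alpha>. C \<alpha> \<ge> 0" "\<And>\<alpha> x. (\<forall>j<n. norm (inner_n n x (c j)) \<ge> \<delta>) \<Longrightarrow>
     norm (pdiffs n \<alpha> (f_cols n c) x) \<le> C \<alpha> * norm (Q x)" by metis
  have "norm (fP_cols n c P x) \<le> (\<Sum>\<alpha>\<in>S. norm (P \<alpha>) * C \<alpha>) * norm (Q x)"
    if x: "\<forall>j<n. norm (inner_n n x (c j)) \<ge> \<delta>" for x
  proof -
    have "\<forall>j<n. inner_n n x (c j) \<noteq> 0" using x assms by fastforce
    then have "fP_cols n c P x = (\<Sum>\<alpha>\<in>S. P \<alpha> * (-1) ^ (\<Sum>i<n. \<alpha> i) * pdiffs n \<alpha> (f_cols n c) x)"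
      by (simp add: fP_cols_def S_def)
    then have "norm (fP_cols n c P x) \<le>
       (\<Sum>\<alpha>\<in>S. norm (P \<alpha> * (-1) ^ (\<Sum>i<n. \<alpha> i) * pdiffs n \<alpha> (f_cols n c) x))"
      by (simp only: norm_sum)
    also have "\<dots> = (\<Sum>\<alpha>\<in>S. norm (P \<alpha>) * norm (pdiffs n \<alpha> (f_cols n c) x))"
      by (simp add: norm_mult norm_power)
    also have "\<dots> \<le> (\<Sum>\<alpha>\<in>S. norm (P \<alpha>) * (C \<alpha> * norm (Q x)))"
      by (intro sum_mono mult_left_mono C x) auto
    finally show ?thesis by (simp add: sum_distrib_right mult.assoc)
  qed
  then show ?thesis
    by (intro exI[of _ "\<Sum>\<alpha>\<in>S. norm (P \<alpha>) * C \<alpha>"] conjI sum_nonneg mult_nonneg_nonneg C)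
      (auto simp: Q_def norm_mult norm_inverse prod_norm[symmetric] mult.assoc)
qed

section \<open>Counting separated points in boxes and dyadic summation\<close>

section \<open>Sums over points separated by their norm\<close>

text \<open>Pigeonhole: the box is cut into cells whose sides are the fraction
  \<open>\<theta>\<close> of the \<open>r i\<close>, and two distinct points in one cell would
  violate the separation. The number of cells gives the bound.\<close>

lemma card_separated_points_le:
  fixes Y :: "(nat \<Rightarrow> complex) set" and r :: "nat \<Rightarrow> real"
  assumes n: "n \<ge> 1" and "finite Y" and c: "c > 0"
    and sep: "\<And>y z. y \<in> Y \<Longrightarrow> z \<in> Y \<Longrightarrow> y \<noteq> z \<Longrightarrow> c \<le> (\<Prod>i<n. norm (y i - z i))"
    and r: "\<And>i. i < n \<Longrightarrow> r i > 0" and cr: "c \<le> (\<Prod>i<n. r i)"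
    and Y: "\<And>y i. y \<in> Y \<Longrightarrow> i < n \<Longrightarrow> norm (y i) \<le> r i"
  shows "real (card Y) \<le> 64 ^ n / c\<^sup>2 * (\<Prod>i<n. r i)\<^sup>2"
proof -
  define R where "R = (\<Prod>i<n. r i)"
  have R: "R > 0" "c \<le> R" using r cr by (auto simp: R_def intro!: prod_pos)
  \<comment> \<open>Chosen so that \<open>(2 * \<theta>) ^ n * R = c\<close> exactly;
    \<open>c \<le> R\<close> then gives \<open>\<theta> \<le> 1/2\<close>.\<close>
  define \<theta> where "\<theta> = root n (c / R) / 2"
  have \<theta>: "\<theta> > 0" "\<theta> \<le> 1/2" "\<theta> ^ n = c / (2 ^ n * R)"
    using n c R by (auto simp: \<theta>_def power_divide field_simps)
  define m where "m = \<lceil>1 / \<theta>\<rceil>"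
  \<comment> \<open>The index of the cell containing \<open>y\<close>, one integer for the real and
    one for the imaginary part of each coordinate.\<close>
  define \<phi> where "\<phi> = (\<lambda>y::nat\<Rightarrow>complex. \<lambda>i\<in>{..<n}. (\<lfloor>Re (y i) / (\<theta> * r i)\<rfloor>, \<lfloor>Im (y i) / (\<theta> * r i)\<rfloor>))"
  have "\<phi> ` Y \<subseteq> PiE {..<n} (\<lambda>_. {-m..m} \<times> {-m..m})"
  proof (intro image_subsetI PiE_I)
    fix y i assume y: "y \<in> Y" and "i \<in> {..<n}"
    then have i: "i < n" by simp
    have *: "\<lfloor>t / (\<theta> * r i)\<rfloor> \<in> {-m..m}" if "\<bar>t\<bar> \<le> r i" for t
    proof -
      have "\<bar>t / (\<theta> * r i)\<bar> \<le> 1 / \<theta>"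
        using that r[OF i] \<theta>(1) by (simp add: abs_mult field_simps)
      then have "t / (\<theta> * r i) \<le> m" "- of_int m \<le> t / (\<theta> * r i)"
        unfolding m_def by linarith+
      then show ?thesis by (auto simp: le_floor_iff floor_le_iff)
    qed
    show "\<phi> y i \<in> {-m..m} \<times> {-m..m}"
      unfolding \<phi>_def using i *[of "Re (y i)"] *[of "Im (y i)"] Y[OF y i]
        abs_Re_le_cmod[of "y i"] abs_Im_le_cmod[of "y i"] by auto
  qed (auto simp: \<phi>_def)
  moreover have "inj_on \<phi> Y"
  proof (rule inj_onI, rule ccontr)
    fix y z assume yz: "y \<in> Y" "z \<in> Y" "\<phi> y = \<phi> z" "y \<noteq> z"
    have less: "norm (y i - z i) < 2 * \<theta> * r i" if i: "i < n" for i
    proof -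
      have *: "\<bar>s - t\<bar> < \<theta> * r i" if "\<lfloor>s / (\<theta> * r i)\<rfloor> = \<lfloor>t / (\<theta> * r i)\<rfloor>" for s t
      proof -
        have "\<bar>s / (\<theta> * r i) - t / (\<theta> * r i)\<bar> < 1" using that by linarith
        then have "\<bar>(s - t) / (\<theta> * r i)\<bar> < 1" by (simp add: diff_divide_distrib)
        then show ?thesis using \<theta>(1) r[OF i] by (simp add: abs_divide field_simps)
      qed
      have "\<phi> y i = \<phi> z i" using yz by simp
      then have "\<bar>Re (y i - z i)\<bar> < \<theta> * r i" "\<bar>Im (y i - z i)\<bar> < \<theta> * r i"
        using i * by (auto simp: \<phi>_def)
      then show ?thesis using cmod_le[of "y i - z i"] by linarith
    qed
    have "(\<Prod>i<n. norm (y i - z i)) < (\<Prod>i<n. 2 * \<theta> * r i)"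
      using n less \<theta>(1) r by (intro prod_mono_strict) (auto intro: less_imp_le)
    also have "\<dots> = 2 ^ n * \<theta> ^ n * R" by (simp add: prod.distrib power_mult_distrib R_def)
    also have "\<dots> = c" using \<theta>(3) R by simp
    finally show False using sep[OF yz(1,2,4)] by simp
  qed
  ultimately have "card Y \<le> card (PiE {..<n} (\<lambda>_. {-m..m} \<times> {-m..m}))"
    by (intro card_inj_on_le finite_PiE) auto
  also have "\<dots> = (nat (2 * m + 1) * nat (2 * m + 1)) ^ n" by (simp add: card_PiE)
  finally have "real (card Y) \<le> real ((nat (2 * m + 1) * nat (2 * m + 1)) ^ n)"
    by (simp only: of_nat_le_iff)
  also have "\<dots> \<le> ((4 / \<theta>) * (4 / \<theta>)) ^ n"
  proof -
    \<comment> \<open>Absorbs the rounding: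
      \<open>2 * m + 1 < 2 / \<theta> + 3 \<le> 4 / \<theta>\<close>.\<close>
    have "1 / \<theta> \<ge> 2" using \<theta> by (simp add: field_simps)
    moreover have "real_of_int m < 1 / \<theta> + 1" unfolding m_def by linarith
    ultimately have "0 \<le> m" "real_of_int (2 * m + 1) \<le> 4 / \<theta>" unfolding m_def by linarith+
    then have "real (nat (2 * m + 1)) \<le> 4 / \<theta>" by linarith
    then show ?thesis
      unfolding of_nat_power of_nat_mult by (intro power_mono mult_mono) (use \<theta> in auto)
  qed
  also have "\<dots> = 16 ^ n / (\<theta> ^ n)\<^sup>2"
    by (simp add: power2_eq_square power_divide power_mult_distrib[symmetric])
  also have "\<dots> = (16 ^ n * 4 ^ n) / c\<^sup>2 * R\<^sup>2"
    unfolding \<theta>(3) using R c by (simp add: field_simps power2_eq_square power_mult_distrib[symmetric])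
  also have "(16 ^ n * 4 ^ n :: real) = 64 ^ n"
    by (simp add: power_mult_distrib[symmetric])
  finally show ?thesis by (simp add: R_def)
qed

text \<open>One geometric series for each sign; the bound is uniform in \<open>A\<close>.\<close>

lemma sum_power_abs_int_le:
  fixes q :: real
  assumes "0 < q" "q < 1" "finite A"
  shows "(\<Sum>j\<in>A. q ^ nat \<bar>j\<bar>) \<le> 2 / (1 - q)"
proof -
  have half: "(\<Sum>j\<in>B. q ^ nat \<bar>j\<bar>) \<le> 1 / (1 - q)" if "finite B" "inj_on (\<lambda>j. nat \<bar>j\<bar>) B" for B
  proof -
    have "(\<Sum>j\<in>B. q ^ nat \<bar>j\<bar>) = sum (\<lambda>k. q ^ k) ((\<lambda>j. nat \<bar>j\<bar>) ` B)"
      using that by (simp add: sum.reindex)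
    also have "\<dots> \<le> (\<Sum>k. q ^ k)"
      using assms that by (intro sum_le_suminf) (auto simp: summable_geometric)
    finally show ?thesis using assms by (simp add: suminf_geometric)
  qed
  have "(\<Sum>j\<in>A. q ^ nat \<bar>j\<bar>) = (\<Sum>j\<in>A \<inter> {0..}. q ^ nat \<bar>j\<bar>) + (\<Sum>j\<in>A \<inter> {..<0}. q ^ nat \<bar>j\<bar>)"
    using assms(3) by (subst sum.union_disjoint[symmetric]) (auto intro!: sum.cong)
  also have "\<dots> \<le> 1 / (1 - q) + 1 / (1 - q)"
    using assms(3) by (intro add_mono half) (auto simp: inj_on_def)
  finally show ?thesis by simp
qed

text \<open>The lower bound \<open>c\<close> on the product turns the decay in the largest coordinate into decay in the
  logarithms of all coordinates.\<close>

lemma inverse_sum_le_prod_power_log: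
  fixes c :: real
  assumes n: "n \<ge> 1" and c: "c > 0"
  obtains B q where "B > 0" "0 < q" "q < 1"
    "\<And>y :: nat \<Rightarrow> real. (\<And>i. i < n \<Longrightarrow> y i > 0) \<Longrightarrow> c \<le> (\<Prod>i<n. y i) \<Longrightarrow>
      1 / (\<Sum>i<n. y i) \<le> B * (\<Prod>i<n. q ^ nat \<bar>\<lfloor>log 2 (y i)\<rfloor>\<bar>)"
proof -
  \<comment> \<open>Makes \<open>Z = B * T\<close> at least 1, at least \<open>1 / c\<close> and at
    least \<open>T\<close>, given that \<open>T \<ge> root n c\<close>.\<close>
  define B where "B = max 1 (1 / c) * max 1 (1 / root n c)"
  \<comment> \<open>The absolute logarithms will sum to at most \<open>n^2 * log 2 Z\<close>, up to
    rounding, so the exponent \<open>1 / n^2\<close> turns that sum into a bound by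
    \<open>log 2 Z\<close>.\<close>
  define q :: real where "q = 2 powr (- 1 / (real n)\<^sup>2)"
  have B: "B > 0" unfolding B_def by (intro mult_pos_pos) auto
  have q: "0 < q" "q < 1" using n by (auto simp: q_def powr_less_one)
  \<comment> \<open>The factor 2 pays for the floors: they add at most \<open>n\<close> to the sum
    of exponents, hence at most \<open>1 / n \<le> 1\<close> after division by
    \<open>n^2\<close>.\<close>
  have "1 / (\<Sum>i<n. y i) \<le> 2 * B * (\<Prod>i<n. q ^ nat \<bar>\<lfloor>log 2 (y i)\<rfloor>\<bar>)"
    if y: "\<And>i. i < n \<Longrightarrow> y i > 0" and cy: "c \<le> (\<Prod>i<n. y i)" for y :: "nat \<Rightarrow> real"
  proof -
    define T where "T = (\<Sum>i<n. y i)"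
    have yT: "y i \<le> T" if "i < n" for i
      unfolding T_def using that y by (intro member_le_sum) (auto intro: less_imp_le)
    have "c \<le> (\<Prod>i<n. T)" 
      by (rule order_trans[OF cy prod_mono]) (auto intro: yT less_imp_le y)
    then have cT: "c \<le> T ^ n" by simp
    have T: "T > 0" using y[of 0] yT[of 0] n by simp
    define Z where "Z = B * T"
    have "root n c \<le> T"
      using real_root_le_mono[OF _ cT, of n] n T by (simp add: real_root_power_cancel)
    moreover have "root n c > 0" using n c by simp
    ultimately have "1 \<le> 1 / root n c * T" by (simp add: field_simps)
    also have "\<dots> \<le> max 1 (1 / root n c) * T" using T by (intro mult_right_mono) auto
    finally have Z1: "max 1 (1 / c) \<le> Z"
      unfolding Z_def B_def using mult_left_mono[of 1 "max 1 (1 / root n c) * T" "max 1 (1 / c)"]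
      by (simp add: mult.assoc)
    then have Z: "Z \<ge> 1" "Z \<ge> 1 / c" by auto
    have "B \<ge> 1" unfolding B_def using mult_mono[of 1 "max 1 (1/c)" 1 "max 1 (1 / root n c)"] by simp
    then have TZ: "T \<le> Z" unfolding Z_def using T by simp
    have log: "\<bar>log 2 (y i)\<bar> \<le> n * log 2 Z" if i: "i < n" for i
    proof -
      have "y i \<le> Z ^ n"
        using yT[OF i] TZ self_le_power[OF Z(1), of n] n by simp
      then have up: "log 2 (y i) \<le> n * log 2 Z"
        using y[OF i] Z(1) by (simp add: log_nat_power[symmetric])
      \<comment> \<open>Small \<open>y i\<close> are excluded because the other \<open>n - 1\<close>
        factors are at most \<open>Z\<close>: this gives
        \<open>1 / y i \<le> Z ^ (n - 1) / c \<le> Z ^ n\<close>.\<close>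
      have "c \<le> y i * (\<Prod>k\<in>{..<n} - {i}. y k)" using cy i by (simp add: prod.remove[symmetric])
      also have "\<dots> \<le> y i * (\<Prod>k\<in>{..<n} - {i}. Z)"
        using y[OF i] by (intro mult_left_mono prod_mono) (auto intro: less_imp_le y order_trans[OF yT TZ])
      also have "\<dots> = y i * Z ^ (n - 1)" using i by simp
      finally have "1 / y i \<le> Z ^ (n - 1) * (1 / c)" using y[OF i] c by (simp add: field_simps)
      also have "\<dots> \<le> Z ^ (n - 1) * Z" using Z by (intro mult_left_mono) auto
      also have "\<dots> = Z ^ n" using n by (simp add: power_eq_if)
      finally have "log 2 (1 / y i) \<le> log 2 (Z ^ n)" using y[OF i] Z(1) by simp
      then have "- log 2 (y i) \<le> n * log 2 Z"
        using y[OF i] Z(1) by (simp add: log_divide log_nat_power)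
      with up show ?thesis by linarith
    qed
    define k where "k = (\<lambda>i. nat \<bar>\<lfloor>log 2 (y i)\<rfloor>\<bar>)"
    have "real (k i) \<le> n * log 2 Z + 1" if "i < n" for i
      using log[OF that] unfolding k_def by linarith
    then have "(\<Sum>i<n. real (k i)) \<le> (\<Sum>i<n. n * log 2 Z + 1)" by (intro sum_mono) auto
    also have "\<dots> = (real n)\<^sup>2 * log 2 Z + n" by (simp add: power2_eq_square algebra_simps)
    finally have "(\<Sum>i<n. real (k i)) / (real n)\<^sup>2 \<le> log 2 Z + 1 / n"
      using n by (simp add: field_simps power2_eq_square)
    also have "\<dots> \<le> log 2 Z + 1" using n by simp
    finally have *: "- log 2 Z \<le> 1 - (\<Sum>i<n. real (k i)) / (real n)\<^sup>2" by simp
    have "1 / Z = 2 powr (- log 2 Z)" using Z(1) by (simp add: powr_minus_divide)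
    also have "\<dots> \<le> 2 powr (1 - (\<Sum>i<n. real (k i)) / (real n)\<^sup>2)" using * by simp
    also have "\<dots> = 2 * 2 powr (\<Sum>i<n. (- 1 / (real n)\<^sup>2) * real (k i))"
      by (simp add: powr_diff sum_negf sum_divide_distrib powr_minus_divide)
    also have "2 powr (\<Sum>i<n. (- 1 / (real n)\<^sup>2) * real (k i)) = (\<Prod>i<n. q ^ k i)"
    proof (subst powr_sum)
      have "2 powr (- 1 / (real n)\<^sup>2 * real (k i)) = q ^ k i" for i
        using powr_realpow[OF q(1), of "k i"] by (simp add: q_def powr_powr)
      then show "(\<Prod>i<n. 2 powr (- 1 / (real n)\<^sup>2 * real (k i))) = (\<Prod>i<n. q ^ k i)" by simp
    qed auto
    finally have "1 / Z \<le> 2 * (\<Prod>i<n. q ^ k i)" .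
    then have "B * (1 / Z) \<le> B * (2 * (\<Prod>i<n. q ^ k i))"
      using B by (intro mult_left_mono) auto
    moreover have "B * (1 / Z) = 1 / T" unfolding Z_def using B T by simp
    ultimately show ?thesis unfolding k_def T_def by (simp add: mult_ac)
  qed
  then show ?thesis using B q by (intro that[of "2 * B" q]) auto
qed

text \<open>The terms are nonnegative, so a bound on finite partial sums that is uniform in the
  finite set is enough. \<open>Y\<close> will be the set of value vectors of the forms at nonzero
  lattice points.\<close>

lemma summable_on_separated_points:
  fixes Y :: "(nat \<Rightarrow> complex) set"
  assumes n: "n \<ge> 1" and c: "c > 0"
    and sep: "\<And>y z. y \<in> Y \<Longrightarrow> z \<in> Y \<Longrightarrow> y \<noteq> z \<Longrightarrow> c \<le> (\<Prod>i<n. norm (y i - z i))"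
    and low: "\<And>y. y \<in> Y \<Longrightarrow> c \<le> (\<Prod>i<n. norm (y i))"
  shows "(\<lambda>y. 1 / (\<Sum>i<n. norm (y i)) * (1 / (\<Prod>i<n. norm (y i))\<^sup>2)) summable_on Y"
proof -
  let ?w = "\<lambda>y::nat\<Rightarrow>complex. 1 / (\<Sum>i<n. norm (y i)) * (1 / (\<Prod>i<n. norm (y i))\<^sup>2)"
  obtain B q where B: "B > 0" and q: "0 < q" "q < 1"
    and Bq: "\<And>y :: nat \<Rightarrow> real. (\<And>i. i < n \<Longrightarrow> y i > 0) \<Longrightarrow> c \<le> (\<Prod>i<n. y i) \<Longrightarrow>
      1 / (\<Sum>i<n. y i) \<le> B * (\<Prod>i<n. q ^ nat \<bar>\<lfloor>log 2 (y i)\<rfloor>\<bar>)"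
    using inverse_sum_le_prod_power_log[OF n c] by blast
  define K where "K = B * (64 ^ n * 4 ^ n / c\<^sup>2)"
  have K: "K > 0" unfolding K_def using B c by simp
  have bound: "sum ?w G \<le> K * (2 / (1 - q)) ^ n" if G: "finite G" "G \<subseteq> Y" for G
  proof -
    \<comment> \<open>The dyadic class of a point, restricted to \<open>{..<n}\<close> so that the
      classes lie in a product set.\<close>
    define a where "a = (\<lambda>y::nat\<Rightarrow>complex. \<lambda>i\<in>{..<n}. \<lfloor>log 2 (norm (y i))\<rfloor>)"
    have pos: "norm (y i) > 0" if "y \<in> G" "i < n" for y i
    proof (rule ccontr)
      assume "\<not> ?thesis"
      then have "(\<Prod>i<n. norm (y i)) = 0" using that by (intro prod_zero) auto
      moreover have "c \<le> (\<Prod>i<n. norm (y i))" using low that G by blast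
      ultimately show False using c by linarith
    qed
    have lo: "2 powr (a y i) \<le> norm (y i)" and hi: "norm (y i) \<le> 2 * 2 powr (a y i)"
      if "y \<in> G" "i < n" for y i
    proof -
      have a: "a y i \<le> log 2 (norm (y i))" "log 2 (norm (y i)) \<le> a y i + 1"
        using that by (auto simp: a_def)
      have e: "2 powr (log 2 (norm (y i))) = norm (y i)" using pos[OF that] by simp
      show "2 powr (a y i) \<le> norm (y i)" 
        using powr_mono[OF a(1), of 2] unfolding e by simp
      show "norm (y i) \<le> 2 * 2 powr (a y i)"
        using powr_mono[OF a(2), of 2] unfolding e by (simp add: powr_add)
    qed
    \<comment> \<open>Within one class the count of order \<open>?E^2\<close> cancels the weight
      \<open>1 / ?E^2\<close>, and only the geometric factor remains.\<close>
    have fibre: "(\<Sum>y\<in>{y\<in>G. a y = \<alpha>}. ?w y) \<le> K * (\<Prod>i<n. q ^ nat \<bar>\<alpha> i\<bar>)" if "\<alpha> \<in> a ` G" for \<alpha>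
    proof -
      let ?H = "{y\<in>G. a y = \<alpha>}" and ?E = "\<Prod>i<n. 2 powr real_of_int (\<alpha> i)"
      have E: "?E > 0" by (intro prod_pos) auto
      have "?w y \<le> B * (\<Prod>i<n. q ^ nat \<bar>\<alpha> i\<bar>) * (1 / ?E\<^sup>2)" if y: "y \<in> ?H" for y
      proof (rule mult_mono)
        have "1 / (\<Sum>i<n. norm (y i)) \<le> B * (\<Prod>i<n. q ^ nat \<bar>\<lfloor>log 2 (norm (y i))\<rfloor>\<bar>)"
          using y G pos low by (intro Bq) auto
        also have "(\<Prod>i<n. q ^ nat \<bar>\<lfloor>log 2 (norm (y i))\<rfloor>\<bar>) = (\<Prod>i<n. q ^ nat \<bar>\<alpha> i\<bar>)"
          using y by (intro prod.cong) (auto simp: a_def)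
        finally show "1 / (\<Sum>i<n. norm (y i)) \<le> B * (\<Prod>i<n. q ^ nat \<bar>\<alpha> i\<bar>)" .
        have "?E \<le> (\<Prod>i<n. norm (y i))" using y lo by (intro prod_mono) auto
        then show "1 / (\<Prod>i<n. norm (y i))\<^sup>2 \<le> 1 / ?E\<^sup>2"
          using E by (intro frac_le power_mono zero_less_power) auto
        show "0 \<le> B * (\<Prod>i<n. q ^ nat \<bar>\<alpha> i\<bar>)" using B q by (auto intro!: prod_nonneg mult_nonneg_nonneg)
      qed auto
      then have *: "(\<Sum>y\<in>?H. ?w y) \<le> real (card ?H) * (B * (\<Prod>i<n. q ^ nat \<bar>\<alpha> i\<bar>) * (1 / ?E\<^sup>2))"
        by (rule sum_bounded_above)
      have "real (card ?H) \<le> 64 ^ n / c\<^sup>2 * (\<Prod>i<n. 2 * 2 powr (\<alpha> i))\<^sup>2"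
      proof (rule card_separated_points_le[OF n _ c])
        \<comment> \<open>Counting needs a box of volume at least \<open>c\<close>; any member of
          the nonempty class shows that its box is large enough.\<close>
        from that obtain y where y: "y \<in> G" "a y = \<alpha>" by auto
        have "(\<Prod>i<n. norm (y i)) \<le> (\<Prod>i<n. 2 * 2 powr (\<alpha> i))"
          using y hi by (intro prod_mono) auto
        then show "c \<le> (\<Prod>i<n. 2 * 2 powr (\<alpha> i))" using low y G by fastforce
        show "c \<le> (\<Prod>i<n. norm (y i - z i))" if "y \<in> ?H" "z \<in> ?H" "y \<noteq> z" for y z
          using that G by (intro sep) auto
      qed (use G hi in auto)
      also have "(\<Prod>i<n. 2 * 2 powr (\<alpha> i))\<^sup>2 = 4 ^ n * ?E\<^sup>2"
      proof -
        have "(2 ^ n)\<^sup>2 = (4::real) ^ n" by (simp add: power2_eq_square power_mult_distrib[symmetric])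
        then show ?thesis by (simp add: prod.distrib power_mult_distrib)
      qed
      finally have "real (card ?H) \<le> 64 ^ n / c\<^sup>2 * (4 ^ n * ?E\<^sup>2)" .
      then have "real (card ?H) * (B * (\<Prod>i<n. q ^ nat \<bar>\<alpha> i\<bar>) * (1 / ?E\<^sup>2)) \<le>
          64 ^ n / c\<^sup>2 * (4 ^ n * ?E\<^sup>2) * (B * (\<Prod>i<n. q ^ nat \<bar>\<alpha> i\<bar>) * (1 / ?E\<^sup>2))"
        using B q by (intro mult_right_mono mult_nonneg_nonneg prod_nonneg) auto
      also have "\<dots> = K * (\<Prod>i<n. q ^ nat \<bar>\<alpha> i\<bar>)"
        using E unfolding K_def by (simp add: mult_ac)
      finally show ?thesis using * by linarith
    qed
    \<comment> \<open>Enlarging the set of occurring classes to a full product lets the sum factor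
      into \<open>n\<close> one-dimensional sums.\<close>
    define A where "A = (\<lambda>i. (\<lambda>y. a y i) ` G)"
    have aA: "a ` G \<subseteq> PiE {..<n} A" by (auto simp: A_def a_def PiE_def extensional_def)
    have "sum ?w G = (\<Sum>\<alpha>\<in>a ` G. \<Sum>y\<in>{y\<in>G. a y = \<alpha>}. ?w y)"
      using G(1) by (rule sum.image_gen)
    also have "\<dots> \<le> (\<Sum>\<alpha>\<in>a ` G. K * (\<Prod>i<n. q ^ nat \<bar>\<alpha> i\<bar>))"
      by (intro sum_mono fibre)
    also have "\<dots> \<le> (\<Sum>\<alpha>\<in>PiE {..<n} A. K * (\<Prod>i<n. q ^ nat \<bar>\<alpha> i\<bar>))"
      using G K q by (intro sum_mono2 aA finite_PiE mult_nonneg_nonneg prod_nonneg) (auto simp: A_def)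
    also have "\<dots> = K * (\<Prod>i<n. \<Sum>j\<in>A i. q ^ nat \<bar>j\<bar>)"
      using G by (subst prod_sum_PiE) (auto simp: A_def sum_distrib_left)
    also have "\<dots> \<le> K * (\<Prod>i<n. 2 / (1 - q))"
      using K q G by (intro mult_left_mono prod_mono conjI sum_nonneg sum_power_abs_int_le) (auto simp: A_def)
    finally show ?thesis by simp
  qed
  show ?thesis
  proof (rule nonneg_bounded_partial_sums_imp_summable_on[where C = "K * (2 / (1 - q)) ^ n"])
    show "?w y \<ge> 0" for y
      by (intro mult_nonneg_nonneg divide_nonneg_nonneg sum_nonneg prod_nonneg zero_le_power) auto
    show "\<forall>\<^sub>F G in finite_subsets_at_top Y. sum ?w G \<le> K * (2 / (1 - q)) ^ n"
      by (rule eventually_finite_subsets_at_top_weakI) (rule bound)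
  qed
qed

section \<open>The bound |psi(x)| = O(1/|x|) at points with bounded denominators\<close>

section \<open>Decay of the cocycle\<close>

text \<open>If the determinant is zero, so is the derivative. Otherwise \<open>x\<close> is bounded
  by the sum of the forms, each form cancels one reciprocal, and the remaining \<open>n - 1\<close>
  reciprocals are at most \<open>1 / \<delta>\<close>.\<close>

lemma sum_norm_mult_fP_cols_le:
  assumes "\<delta> > 0"
  shows "\<exists>C\<ge>0. \<forall>x. (\<forall>j<n. norm (inner_n n x (c j)) \<ge> \<delta>) \<longrightarrow>
    (\<Sum>i<n. norm (x i)) * norm (fP_cols n c P x) \<le> C"
proof -
  let ?det = "det_n n (\<lambda>i j. c j i)"
  obtain C where C: "C \<ge> 0" "\<And>x. (\<forall>j<n. norm (inner_n n x (c j)) \<ge> \<delta>) \<Longrightarrow>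
    norm (fP_cols n c P x) \<le> C * norm ?det * (\<Prod>j<n. inverse (norm (inner_n n x (c j))))"
    using norm_fP_cols_le[OF assms, of n c P] by blast
  show ?thesis
  proof (cases "?det = 0")
    case True
    with C show ?thesis by (intro exI[of _ 0]) auto
  next
    case False
    obtain E where E: "E > 0" "\<And>x. (\<Sum>i<n. norm (x i)) \<le> E * (\<Sum>j<n. norm (inner_n n x (c j)))"
      using sum_norm_le_inner_columns[OF False] unfolding Defs.col_def by metis
    have "(\<Sum>i<n. norm (x i)) * norm (fP_cols n c P x) \<le> E * C * norm ?det * (n * inverse \<delta> ^ (n - 1))"
      if x: "\<forall>j<n. norm (inner_n n x (c j)) \<ge> \<delta>" for x
    proof -
      let ?l = "\<lambda>j. norm (inner_n n x (c j))"
      have "?l j * (\<Prod>k<n. inverse (?l k)) \<le> inverse \<delta> ^ (n - 1)" if "j < n" for j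
      proof -
        have "?l j > 0" using x that assms by fastforce
        then have "?l j * (\<Prod>k<n. inverse (?l k)) = (\<Prod>k\<in>{..<n} - {j}. inverse (?l k))"
          using that by (subst prod.remove[of _ j]) auto
        also have "\<dots> \<le> (\<Prod>k\<in>{..<n} - {j}. inverse \<delta>)"
          using x assms by (intro prod_mono) (auto intro!: le_imp_inverse_le)
        finally show ?thesis using that by simp
      qed
      then have "(\<Sum>j<n. ?l j * (\<Prod>k<n. inverse (?l k))) \<le> (\<Sum>j<n. inverse \<delta> ^ (n - 1))"
        by (intro sum_mono) auto
      then have *: "(\<Sum>j<n. ?l j) * (\<Prod>k<n. inverse (?l k)) \<le> n * inverse \<delta> ^ (n - 1)"
        by (simp add: sum_distrib_right)
      have "(\<Sum>i<n. norm (x i)) * norm (fP_cols n c P x) \<le>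
          (E * (\<Sum>j<n. ?l j)) * (C * norm ?det * (\<Prod>j<n. inverse (?l j)))"
        using E(1) by (intro mult_mono E(2) C(2)[OF x] mult_nonneg_nonneg sum_nonneg) auto
      also have "\<dots> = E * C * norm ?det * ((\<Sum>j<n. ?l j) * (\<Prod>k<n. inverse (?l k)))"
        by (simp add: mult_ac)
      also have "\<dots> \<le> E * C * norm ?det * (n * inverse \<delta> ^ (n - 1))"
        using E(1) C(1) by (intro mult_left_mono *) auto
      finally show ?thesis .
    qed
    with E(1) C(1) assms show ?thesis
      by (intro exI[of _ "E * C * norm ?det * (n * inverse \<delta> ^ (n - 1))"]) auto
  qed
qed

text \<open>An equality of functions rather than of values, since the function is differentiated
  afterwards.\<close>

lemma f_cols_cong:
  assumes "\<And>j. j < n \<Longrightarrow> c j = c' j"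
  shows "f_cols n c = f_cols n c'"
proof
  fix x
  have "det_n n (\<lambda>i j. c j i) = det_n n (\<lambda>i j. c' j i)" by (rule det_n_cong) (simp add: assms)
  moreover have "(\<Prod>j<n. inner_n n x (c j)) = (\<Prod>j<n. inner_n n x (c' j))"
    by (intro prod.cong) (auto simp: assms)
  moreover have "(\<forall>j<n. inner_n n x (c j) \<noteq> 0) \<longleftrightarrow> (\<forall>j<n. inner_n n x (c' j) \<noteq> 0)"
    by (simp add: assms)
  ultimately show "f_cols n c x = f_cols n c' x" by (simp only: f_cols_def)
qed

text \<open>Lets the choice of columns be restricted to \<open>{..<n}\<close>, so that only finitely
  many choices occur.\<close>

lemma fP_cols_cong:
  assumes "\<And>j. j < n \<Longrightarrow> c j = c' j"
  shows "fP_cols n c P x = fP_cols n c' P x"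
proof -
  have "f_cols n c = f_cols n c'" by (rule f_cols_cong[OF assms])
  moreover have "(\<forall>j<n. inner_n n x (c j) \<noteq> 0) \<longleftrightarrow> (\<forall>j<n. inner_n n x (c' j) \<noteq> 0)"
    by (simp add: assms)
  ultimately show ?thesis by (simp only: fP_cols_def)
qed

text \<open>\<open>D * E\<close> times the value of the form is a nonzero element of the
  order.\<close>

lemma norm_inner_n_ge:
  assumes d: "d > 0" and D: "D > 0" "E > 0"
    and x: "\<And>i. i < n \<Longrightarrow> of_int D * x i \<in> quad_order d"
    and v: "\<And>i. i < n \<Longrightarrow> of_int E * v i \<in> quad_order d"
    and nz: "inner_n n x v \<noteq> 0"
  shows "norm (inner_n n x v) \<ge> 1 / (of_int D * of_int E)"
proof -
  have "of_int D * of_int E * inner_n n x v = (\<Sum>i<n. (of_int D * x i) * (of_int E * v i))"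
    unfolding inner_n_def sum_distrib_left by (simp add: mult_ac)
  also have "\<dots> \<in> quad_order d"
    by (rule quad_order_sum[OF d], rule quad_order_mult[OF d], rule x, simp, rule v, simp)
  finally have "norm (of_int D * of_int E * inner_n n x v) \<ge> 1"
    using D nz by (intro norm_quad_order_ge_1[OF d]) auto
  then show ?thesis using D by (simp add: norm_mult field_simps)
qed

text \<open>The chosen forms do not vanish at \<open>x\<close>, so discreteness bounds them below by
  one \<open>\<delta>\<close>. The choice \<open>J\<close> varies with \<open>x\<close> but stays in
  a finite set, and the sum of the constants over that set serves for all \<open>x\<close>.\<close>

lemma sum_norm_mult_psi_le:
  assumes d: "d > 0" and D: "D > 0"
    and A: "\<And>k i j. k < n \<Longrightarrow> i < n \<Longrightarrow> j < n \<Longrightarrow> of_int D * AA k i j \<in> quad_order d"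
    and det: "\<And>k. k < n \<Longrightarrow> det_n n (AA k) \<noteq> 0"
  obtains C where "C \<ge> 0" "\<And>x. (\<And>i. i < n \<Longrightarrow> of_int D * x i \<in> quad_order d) \<Longrightarrow>
    (\<Sum>i<n. norm (x i)) * norm (psi n AA P x) \<le> C"
proof -
  define \<delta> :: real where "\<delta> = 1 / (of_int D * of_int D)"
  have \<delta>: "\<delta> > 0" using D by (simp add: \<delta>_def)
  define cc where "cc = (\<lambda>J k. Defs.col (AA k) (J k))"
  have "\<forall>J. \<exists>C\<ge>0. \<forall>x. (\<forall>j<n. norm (inner_n n x (cc J j)) \<ge> \<delta>) \<longrightarrow>
    (\<Sum>i<n. norm (x i)) * norm (fP_cols n (cc J) P x) \<le> C"
    using sum_norm_mult_fP_cols_le[OF \<delta>] by blast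
  then obtain C where C: "\<And>J. C J \<ge> 0" "\<And>J x. (\<forall>j<n. norm (inner_n n x (cc J j)) \<ge> \<delta>) \<Longrightarrow>
    (\<Sum>i<n. norm (x i)) * norm (fP_cols n (cc J) P x) \<le> C J" by metis
  define \<J> where "\<J> = PiE {..<n} (\<lambda>_. {..<n})"
  have fin: "finite \<J>" unfolding \<J>_def by (intro finite_PiE) auto
  show ?thesis
  proof (rule that[of "\<Sum>J\<in>\<J>. C J"])
    show "0 \<le> (\<Sum>J\<in>\<J>. C J)" using C(1) by (intro sum_nonneg)
    fix x assume x: "\<And>i. i < n \<Longrightarrow> of_int D * x i \<in> quad_order d"
    show "(\<Sum>i<n. norm (x i)) * norm (psi n AA P x) \<le> (\<Sum>J\<in>\<J>. C J)"
    proof (cases "\<forall>i<n. x i = 0")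
      case True
      then show ?thesis using \<open>0 \<le> (\<Sum>J\<in>\<J>. C J)\<close> by simp
    next
      case False
      then obtain i0 where i0: "i0 < n" "x i0 \<noteq> 0" by blast
      define J where "J = (\<lambda>k\<in>{..<n}. LEAST j. inner_n n x (Defs.col (AA k) j) \<noteq> 0)"
      \<comment> \<open>Invertibility of \<open>AA k\<close> provides a nonvanishing column below
        \<open>n\<close>, so the \<open>LEAST\<close> is attained and lies in range.\<close>
      have J: "J k < n" "inner_n n x (cc J k) \<noteq> 0" if k: "k < n" for k
      proof -
        obtain j where j: "j < n" "inner_n n x (Defs.col (AA k) j) \<noteq> 0"
          using exists_inner_column_nonzero[OF det[OF k] i0(1), of x] i0(2) by blast
        show "J k < n" using Least_le[of "\<lambda>j. inner_n n x (Defs.col (AA k) j) \<noteq> 0", OF j(2)] j(1) k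
          by (simp add: J_def)
        show "inner_n n x (cc J k) \<noteq> 0"
          using LeastI[of "\<lambda>j. inner_n n x (Defs.col (AA k) j) \<noteq> 0", OF j(2)] k
          by (simp add: J_def cc_def)
      qed
      have "J \<in> \<J>" unfolding \<J>_def using J(1) by (auto simp: J_def)
      have "psi n AA P x = fP_cols n (cc J) P x"
        unfolding psi_def using False by (simp only: if_False) (rule fP_cols_cong, simp add: cc_def J_def)
      moreover have "\<forall>k<n. norm (inner_n n x (cc J k)) \<ge> \<delta>"
        unfolding \<delta>_def using J x A by (intro allI impI norm_inner_n_ge[OF d D D]) (auto simp: cc_def Defs.col_def)
      ultimately have "(\<Sum>i<n. norm (x i)) * norm (psi n AA P x) \<le> C J" using C(2) by simp
      also have "C J \<le> (\<Sum>J\<in>\<J>. C J)"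
        using fin C(1) \<open>J \<in> \<J>\<close> by (intro member_le_sum) auto
      finally show ?thesis .
    qed
  qed
qed

section \<open>The product of the forms as a norm from K to F, and its lower bound\<close>

section \<open>The norm form\<close>

lemma embedding_over_sum:
  assumes K: "subfield_C K" and "embedding_over K F \<rho>" and "\<And>i. i \<in> I \<Longrightarrow> f i \<in> K"
  shows "sum f I \<in> K \<and> \<rho> (sum f I) = (\<Sum>i\<in>I. \<rho> (f i))"
proof -
  have K0: "0 \<in> K" using K by (simp add: subfield_C_def)
  \<comment> \<open>\<open>\<rho> 0 = 0\<close> is not part of \<open>embedding_over\<close>; it
    follows from additivity.\<close>
  then have "\<rho> (0 + 0) = \<rho> 0 + \<rho> 0" using assms(2) unfolding embedding_over_def by blast
  then have \<rho>0: "\<rho> 0 = 0" by simp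
  show ?thesis using assms(3)
  proof (induction I rule: infinite_finite_induct)
    case (insert i I)
    then show ?case using K assms(2) unfolding subfield_C_def embedding_over_def by simp
  qed (use K0 \<rho>0 in auto)
qed

lemma embedding_over_eq_0_iff:
  assumes K: "subfield_C K" and \<rho>: "embedding_over K F \<rho>" and z: "z \<in> K"
  shows "\<rho> z = 0 \<longleftrightarrow> z = 0"
proof
  show "z = 0 \<Longrightarrow> \<rho> z = 0" using embedding_over_sum[OF K \<rho>, of "{}"] by simp
  show "\<rho> z = 0 \<Longrightarrow> z = 0"
  proof (rule ccontr)
    assume h: "\<rho> z = 0" "z \<noteq> 0"
    then have "\<rho> (z * inverse z) = \<rho> z * \<rho> (inverse z)"
      using K \<rho> z unfolding subfield_C_def embedding_over_def by blast
    then show False using h \<rho> by (simp add: embedding_over_def)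
  qed
qed

lemma embedding_over_lincomb:
  assumes K: "subfield_C K" and FK: "F \<subseteq> K" and \<rho>: "embedding_over K F \<rho>"
    and "\<And>i. i < n \<Longrightarrow> c i \<in> F" "\<And>i. i < n \<Longrightarrow> b i \<in> K"
  shows "(\<Sum>i<n. c i * b i) \<in> K \<and> \<rho> (\<Sum>i<n. c i * b i) = (\<Sum>i<n. c i * \<rho> (b i))"
proof -
  have "c i * b i \<in> K" "\<rho> (c i * b i) = c i * \<rho> (b i)" if "i < n" for i
    using that K FK \<rho> assms(4,5) unfolding subfield_C_def embedding_over_def by (metis subsetD)+
  then show ?thesis using embedding_over_sum[OF K \<rho>, of "{..<n}" "\<lambda>i. c i * b i"] by simp
qed

text \<open>The product of the linear forms is the norm from the extension field, computed as the
  determinant of multiplication in a basis; this keeps it in \<open>F\<close> with bounded denominators.\<close>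

lemma R_n_norm_form:
  assumes M: "M \<in> R_n n F"
  obtains T where "\<And>j a b. j < n \<Longrightarrow> a < n \<Longrightarrow> b < n \<Longrightarrow> T j a b \<in> F"
    and "\<And>x. (\<Prod>l<n. inner_n n x (Defs.col M l)) = det_n n (\<lambda>a b. \<Sum>j<n. x j * T j a b)"
    and "\<And>x l. (\<And>i. i < n \<Longrightarrow> x i \<in> F) \<Longrightarrow> \<exists>i<n. x i \<noteq> 0 \<Longrightarrow> l < n \<Longrightarrow> inner_n n x (Defs.col M l) \<noteq> 0"
proof -
  obtain K \<rho> m where detM: "det_n n M \<noteq> 0" and K: "subfield_C K" and FK: "F \<subseteq> K"
    and deg: "ext_degree_eq K F n" and all: "\<forall>j<n. embedding_over K F (\<rho> j)"
    "\<forall>i<n. m i \<in> K" "\<forall>i<n. \<forall>j<n. M i j = \<rho> j (m i)"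
    using M unfolding R_n_def mem_Collect_eq by (elim conjE exE)
  then have \<rho>: "\<And>j. j < n \<Longrightarrow> embedding_over K F (\<rho> j)" and m: "\<And>i. i < n \<Longrightarrow> m i \<in> K"
    and Mm: "\<And>i j. i < n \<Longrightarrow> j < n \<Longrightarrow> M i j = \<rho> j (m i)"
    by simp_all
  obtain b where b: "\<And>i. i < n \<Longrightarrow> b i \<in> K"
    and span: "\<forall>z\<in>K. \<exists>!c. (\<forall>i<n. c i \<in> F) \<and> (\<forall>i\<ge>n. c i = 0) \<and> z = (\<Sum>i<n. c i * b i)"
    using deg unfolding ext_degree_eq_def by blast
  have "\<forall>z\<in>K. \<exists>c. (\<forall>i<n. c i \<in> F) \<and> z = (\<Sum>i<n. c i * b i)"
    using span by (meson ex1_implies_ex)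
  then obtain coord where coord: "\<And>z i. z \<in> K \<Longrightarrow> i < n \<Longrightarrow> coord z i \<in> F"
    "\<And>z. z \<in> K \<Longrightarrow> z = (\<Sum>i<n. coord z i * b i)" by metis
  \<comment> \<open>The conjugates of the basis. \<open>M\<close> is the coordinate matrix of the
    \<open>m i\<close> times \<open>R\<close>, so \<open>R\<close> inherits a nonzero determinant
    from \<open>M\<close>.\<close>
  define R where "R = (\<lambda>a l. \<rho> l (b a))"
  have \<rho>_coord: "\<rho> l z = (\<Sum>a<n. coord z a * R a l)" if "z \<in> K" "l < n" for z l
    using embedding_over_lincomb[OF K FK \<rho>[OF that(2)], of n "coord z" b] coord that b
    unfolding R_def by auto
  have "det_n n M = det_n n (\<lambda>i j. \<Sum>k<n. coord (m i) k * R k j)"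
    by (rule det_n_cong) (simp add: Mm \<rho>_coord m)
  then have detR: "det_n n R \<noteq> 0" using detM unfolding det_n_mult by auto
  \<comment> \<open>\<open>T j\<close> is the matrix of multiplication by \<open>m j\<close> in the
    basis \<open>b\<close>; the columns of \<open>R\<close> are its eigenvectors, with eigenvalues
    \<open>M j l\<close>.\<close>
  define T where "T = (\<lambda>j a. coord (m j * b a))"
  have mb: "m j * b a \<in> K" if "j < n" "a < n" for j a
    using K m b that unfolding subfield_C_def by blast
  have MR: "M j l * R a l = (\<Sum>c<n. T j a c * R c l)" if "j < n" "a < n" "l < n" for j a l
  proof -
    have "M j l * R a l = \<rho> l (m j * b a)"
      using \<rho>[OF that(3)] m b that unfolding embedding_over_def by (simp add: Mm R_def)
    then show ?thesis using \<rho>_coord[OF mb] that by (simp add: T_def)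
  qed
  show ?thesis
  proof (rule that[of T])
    show "T j a c \<in> F" if "j < n" "a < n" "c < n" for j a c
      unfolding T_def using that mb coord by blast
  next
    fix x
    \<comment> \<open>Taken with weights \<open>x j\<close>, the eigenvector equations say that (sum
      of \<open>x j * T j\<close>) times \<open>R\<close> is \<open>R\<close> with its columns
      scaled by the forms. Taking determinants and cancelling that of \<open>R\<close> gives the
      identity.\<close>
    have "(\<Prod>l<n. inner_n n x (Defs.col M l)) * det_n n R =
        det_n n (\<lambda>a l. R a l * inner_n n x (Defs.col M l))"
      by (simp add: det_n_scale_columns)
    also have "\<dots> = det_n n (\<lambda>a l. \<Sum>c<n. (\<Sum>j<n. x j * T j a c) * R c l)"
    proof (rule det_n_cong)
      fix a l assume "a < n" "l < n"
      then have "R a l * inner_n n x (Defs.col M l) = (\<Sum>j<n. x j * (\<Sum>c<n. T j a c * R c l))"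
        unfolding inner_n_def Defs.col_def sum_distrib_left[of "R a l"]
        by (intro sum.cong) (auto simp: MR[symmetric])
      also have "\<dots> = (\<Sum>c<n. (\<Sum>j<n. x j * T j a c) * R c l)"
        unfolding sum_distrib_left sum_distrib_right by (subst sum.swap) (simp add: mult_ac)
      finally show "R a l * inner_n n x (Defs.col M l) = (\<Sum>c<n. (\<Sum>j<n. x j * T j a c) * R c l)" .
    qed
    also have "\<dots> = det_n n (\<lambda>a c. \<Sum>j<n. x j * T j a c) * det_n n R"
      by (rule det_n_mult)
    finally show "(\<Prod>l<n. inner_n n x (Defs.col M l)) = det_n n (\<lambda>a c. \<Sum>j<n. x j * T j a c)"
      using detR by simp
  next
    fix x l assume x: "\<And>i. i < n \<Longrightarrow> x i \<in> F" "\<exists>i<n. x i \<noteq> 0" and l: "l < n"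
    \<comment> \<open>The forms at \<open>x\<close> are the conjugates of \<open>\<beta>\<close>.
      One is nonzero because \<open>M\<close> is invertible, so \<open>\<beta> \<noteq> 0\<close>
      and all conjugates are nonzero.\<close>
    define \<beta> where "\<beta> = (\<Sum>i<n. x i * m i)"
    have \<beta>: "\<beta> \<in> K" and in\<beta>: "\<And>l. l < n \<Longrightarrow> inner_n n x (Defs.col M l) = \<rho> l \<beta>"
      using embedding_over_lincomb[OF K FK \<rho>, of _ n x m] x m l
      unfolding \<beta>_def by (auto simp: inner_n_def Defs.col_def Mm)
    obtain l' where "l' < n" "\<rho> l' \<beta> \<noteq> 0"
      using exists_inner_column_nonzero[OF detM] x(2) in\<beta> by metis
    then have "\<beta> \<noteq> 0" using embedding_over_eq_0_iff[OF K \<rho> \<beta>] by blast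
    then show "inner_n n x (Defs.col M l) \<noteq> 0"
      using embedding_over_eq_0_iff[OF K \<rho>[OF l] \<beta>] in\<beta>[OF l] by simp
  qed
qed

text \<open>Scaling the determinant of the norm form column by column with \<open>N\<close> puts all
  its entries into the order. Then \<open>N ^ n\<close> times the product is a nonzero element
  there.\<close>

lemma R_n_prod_norm_ge:
  assumes d: "d > 0"
    and F: "F = {of_rat a + of_rat b * (\<i> * of_real (sqrt (real_of_int d))) | a b. True}"
    and M: "M \<in> R_n n F" and D: "D > 0"
  obtains c where "c > 0" "\<And>x. (\<And>i. i < n \<Longrightarrow> of_int D * x i \<in> quad_order d) \<Longrightarrow>
    \<exists>i<n. x i \<noteq> 0 \<Longrightarrow> c \<le> (\<Prod>l<n. norm (inner_n n x (Defs.col M l)))"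
proof -
  obtain T where T: "\<And>j a b. j < n \<Longrightarrow> a < n \<Longrightarrow> b < n \<Longrightarrow> T j a b \<in> F"
    and det: "\<And>x. (\<Prod>l<n. inner_n n x (Defs.col M l)) = det_n n (\<lambda>a b. \<Sum>j<n. x j * T j a b)"
    and nz: "\<And>x l. (\<And>i. i < n \<Longrightarrow> x i \<in> F) \<Longrightarrow> \<exists>i<n. x i \<noteq> 0 \<Longrightarrow> l < n \<Longrightarrow> inner_n n x (Defs.col M l) \<noteq> 0"
    using R_n_norm_form[OF M] by blast
  define Z where "Z = (\<lambda>(j, a, b). T j a b) ` ({..<n} \<times> {..<n} \<times> {..<n})"
  have "finite Z" "Z \<subseteq> F" unfolding Z_def using T by auto
  then obtain E where E: "E > 0" "\<forall>z\<in>Z. of_int E * z \<in> quad_order d"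
    using common_denominator[OF d, of Z] unfolding F by blast
  have ET: "of_int E * T j a b \<in> quad_order d" if "j < n" "a < n" "b < n" for j a b
    using E(2) that unfolding Z_def by auto
  \<comment> \<open>\<open>D\<close> clears the denominators of \<open>x\<close>, \<open>E\<close>
    those of \<open>T\<close>.\<close>
  define N where "N = D * E"
  have N: "N > 0" using D E by (simp add: N_def)
  show ?thesis
  proof (rule that[of "1 / of_int N ^ n"])
    show "1 / real_of_int N ^ n > 0" using N by simp
    fix x assume x: "\<And>i. i < n \<Longrightarrow> of_int D * x i \<in> quad_order d" "\<exists>i<n. x i \<noteq> 0"
    have xF: "x i \<in> F" if i: "i < n" for i
    proof -
      obtain a b where "of_int D * x i = of_int a + of_int b * (\<i> * of_real (sqrt (real_of_int d)))"
        using x(1)[OF i] unfolding quad_order_def by blast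
      then have "x i = of_rat (of_int a / of_int D) + of_rat (of_int b / of_int D) * (\<i> * of_real (sqrt (real_of_int d)))"
        using D by (simp add: of_rat_divide field_simps)
      then show ?thesis unfolding F by blast
    qed
    let ?t = "\<lambda>a b. \<Sum>j<n. x j * T j a b"
    have p0: "(\<Prod>l<n. inner_n n x (Defs.col M l)) \<noteq> 0"
      using nz xF x(2) by (simp add: prod_zero_iff)
    have "?t a b * of_int N = (\<Sum>j<n. (of_int D * x j) * (of_int E * T j a b))" for a b
      unfolding sum_distrib_right N_def by (simp add: mult_ac)
    then have "?t a b * of_int N \<in> quad_order d" if "a < n" "b < n" for a b
      using that by (simp only:) (intro quad_order_sum[OF d] quad_order_mult[OF d, OF x(1) ET]; simp)
    then have "det_n n (\<lambda>a b. ?t a b * of_int N) \<in> quad_order d"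
      by (rule quad_order_det_n[OF d])
    then have "of_int N ^ n * (\<Prod>l<n. inner_n n x (Defs.col M l)) \<in> quad_order d"
      unfolding det_n_scale_columns det by simp
    then have "norm (of_int N ^ n * (\<Prod>l<n. inner_n n x (Defs.col M l))) \<ge> 1"
      using p0 N by (intro norm_quad_order_ge_1[OF d]) auto
    then show "1 / of_int N ^ n \<le> (\<Prod>l<n. norm (inner_n n x (Defs.col M l)))"
      using N by (simp add: norm_mult norm_power prod_norm field_simps)
  qed
qed

section \<open>Comparison of the series with the summable weight\<close>

section \<open>Convergence\<close>

text \<open>The absolute value is \<open>R powr (k - 2 * Re s)\<close>. Splitting off
  \<open>R powr (- 2)\<close> leaves a negative exponent, and that factor is largest at the lower
  bound \<open>c\<close> of \<open>R\<close>.\<close>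

lemma norm_Omega_le:
  assumes c: "c > 0" "c \<le> (\<Prod>i<n. norm (inner_n n x (Defs.col M i)))" and s: "Re s > 1 + real_of_int k / 2"
  shows "norm (Omega n s k x M) \<le>
    c powr (2 + real_of_int k - 2 * Re s) * (1 / (\<Prod>i<n. norm (inner_n n x (Defs.col M i)))\<^sup>2)"
proof -
  let ?L = "\<lambda>i. inner_n n x (Defs.col M i)"
  define R where "R = (\<Prod>i<n. norm (?L i))"
  have R: "c \<le> R" "R > 0" using c by (auto simp: R_def)
  have nz: "norm (?L i) > 0" if "i < n" for i
  proof (rule ccontr)
    assume "\<not> ?thesis"
    then have "R = 0" unfolding R_def using that by (intro prod_zero) auto
    then show False using R by simp
  qed
  have eq: "norm (cnj (?L i) powi k / complex_of_real (norm (?L i)) powr (2 * s)) =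
      norm (?L i) powr (real_of_int k - 2 * Re s)" if "i < n" for i
    using nz[OF that]
    by (simp add: norm_divide norm_power_int norm_powr_real_powr powr_diff powr_real_of_int')
  have "norm (Omega n s k x M) = (\<Prod>i<n. norm (?L i) powr (real_of_int k - 2 * Re s))"
    unfolding Omega_def prod_norm[symmetric] by (rule prod.cong[OF refl], rule eq, simp)
  also have "\<dots> = R powr (real_of_int k - 2 * Re s)"
    unfolding R_def by (rule prod_powr_distrib[symmetric])
  also have "\<dots> = R powr (2 + real_of_int k - 2 * Re s) * R powr (- 2)"
    unfolding powr_add[symmetric] by (simp add: algebra_simps)
  also have "R powr (- 2) = 1 / R\<^sup>2"
    using R(2) by (simp add: powr_minus_divide)
  also have "R powr (2 + real_of_int k - 2 * Re s) * (1 / R\<^sup>2) \<le>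
      c powr (2 + real_of_int k - 2 * Re s) * (1 / R\<^sup>2)"
    using R c(1) s by (intro mult_right_mono powr_mono2') auto
  finally show ?thesis by (simp add: R_def)
qed

text \<open>Converts decay in \<open>x\<close> into decay in the values of the forms, the variables
  in which the points are counted.\<close>

lemma sum_norm_inner_columns_le:
  obtains C where "C > 0" "\<And>x. (\<Sum>j<n. norm (inner_n n x (Defs.col M j))) \<le> C * (\<Sum>i<n. norm (x i))"
proof -
  define C where "C = 1 + (\<Sum>j<n. \<Sum>i<n. norm (M i j))"
  have C: "C > 0" unfolding C_def by (intro add_pos_nonneg sum_nonneg) auto
  have "(\<Sum>j<n. norm (inner_n n x (Defs.col M j))) \<le> C * (\<Sum>i<n. norm (x i))" for x
  proof -
    have "(\<Sum>j<n. norm (inner_n n x (Defs.col M j))) \<le> (\<Sum>j<n. \<Sum>i<n. norm (x i) * norm (M i j))"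
      unfolding inner_n_def Defs.col_def
      by (rule sum_mono) (rule order_trans[OF norm_sum], simp add: norm_mult)
    also have "\<dots> \<le> (\<Sum>j<n. \<Sum>i<n. (\<Sum>i<n. norm (x i)) * norm (M i j))"
      by (intro sum_mono mult_right_mono member_le_sum) auto
    also have "\<dots> = (\<Sum>i<n. norm (x i)) * (\<Sum>j<n. \<Sum>i<n. norm (M i j))"
      by (simp add: sum_distrib_left)
    also have "\<dots> \<le> (\<Sum>i<n. norm (x i)) * C"
      unfolding C_def by (intro mult_left_mono sum_nonneg) auto
    finally show ?thesis by (simp add: mult.commute)
  qed
  with C show ?thesis by (rule that)
qed

lemma inner_n_diff_left: "inner_n n (\<lambda>i. x i - y i) v = inner_n n x v - inner_n n y v"
  by (simp add: inner_n_def algebra_simps sum_subtractf)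

text \<open>A point is \<open>u\<close> plus an integral combination of two generators in each
  coordinate, so clearing finitely many denominators suffices. The set \<open>Z\<close> lets the
  same \<open>D\<close> serve the matrix entries.\<close>

lemma shifted_lattice_common_denominator:
  assumes d: "d > 0"
    and F: "F = {of_rat a + of_rat b * (\<i> * of_real (sqrt (real_of_int d))) | a b. True}"
    and \<Lambda>: "\<forall>i<n. lattice_in F (\<Lambda> i)" and u: "\<forall>i<n. u i \<in> F"
    and Z: "finite Z" "Z \<subseteq> F"
  obtains D where "D > 0" "\<And>z. z \<in> Z \<Longrightarrow> of_int D * z \<in> quad_order d"
    "\<And>x i. x \<in> shifted_lattice n \<Lambda> u \<Longrightarrow> i < n \<Longrightarrow> of_int D * x i \<in> quad_order d"
proof -
  have "\<forall>i. \<exists>w1 w2. i < n \<longrightarrow> w1 \<in> F \<and> w2 \<in> F \<and> \<Lambda> i = {of_int a * w1 + of_int b * w2 | a b. True}"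
    using \<Lambda> unfolding lattice_in_def by meson
  then obtain w1 w2 where w: "\<And>i. i < n \<Longrightarrow> w1 i \<in> F" "\<And>i. i < n \<Longrightarrow> w2 i \<in> F"
    "\<And>i. i < n \<Longrightarrow> \<Lambda> i = {of_int a * w1 i + of_int b * w2 i | a b. True}" by metis
  define Z' where "Z' = Z \<union> u ` {..<n} \<union> w1 ` {..<n} \<union> w2 ` {..<n}"
  have "finite Z'" "Z' \<subseteq> F" using Z u w unfolding Z'_def by auto
  then obtain D where D: "D > 0" "\<forall>z\<in>Z'. of_int D * z \<in> quad_order d"
    using common_denominator[OF d, of Z'] unfolding F by blast
  show ?thesis
  proof (rule that[OF D(1)])
    show "of_int D * z \<in> quad_order d" if "z \<in> Z" for z using D(2) that by (simp add: Z'_def)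
    fix x i assume x: "x \<in> shifted_lattice n \<Lambda> u" and i: "i < n"
    then have "x i - u i \<in> \<Lambda> i" by (simp add: shifted_lattice_def)
    then obtain a b where "x i - u i = of_int a * w1 i + of_int b * w2 i"
      using w(3)[OF i] by blast
    then have "x i = u i + (of_int a * w1 i + of_int b * w2 i)" by (simp add: algebra_simps)
    then have "of_int D * x i = of_int D * u i + (of_int a * (of_int D * w1 i) + of_int b * (of_int D * w2 i))"
      by (simp add: algebra_simps)
    also have "\<dots> \<in> quad_order d"
    proof -
      have h: "of_int D * u i \<in> quad_order d" "of_int D * w1 i \<in> quad_order d" "of_int D * w2 i \<in> quad_order d"
        using D(2) i by (auto simp: Z'_def)
      note mult = quad_order_mult[OF d of_int_in_quad_order[OF d]]
      show ?thesis by (rule quad_order_add[OF d h(1) quad_order_add[OF d mult[OF h(2)] mult[OF h(3)]]])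
    qed
    finally show "of_int D * x i \<in> quad_order d" .
  qed
qed

theorem theorem3:
  fixes n :: nat and F :: "complex set" and \<Lambda> :: "nat \<Rightarrow> complex set"
    and AA :: "nat \<Rightarrow> nat \<Rightarrow> nat \<Rightarrow> complex" and P :: "(nat \<Rightarrow> nat) \<Rightarrow> complex"
    and u :: "nat \<Rightarrow> complex" and M :: "nat \<Rightarrow> nat \<Rightarrow> complex" and k :: int and s :: complex
  assumes "n \<ge> 1"
    and "imag_quad_field F"
    and "\<forall>i<n. lattice_in F (\<Lambda> i) \<and> multiplier_ring (\<Lambda> i) = ring_of_integers F"
    and "\<forall>i<n. AA i \<in> GL_n_over n F"
    and "homogeneous_poly_n n P"
    and "\<forall>i<n. u i \<in> F"
    and "M \<in> R_n n F"
    and "Re s > 1 + real_of_int k / 2"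
  shows "(\<lambda>x. norm (psi n AA P x * Omega n s k x M)) summable_on shifted_lattice n \<Lambda> u"
proof -
  let ?X = "shifted_lattice n \<Lambda> u"
  obtain d where d: "d > 0" 
    and F: "F = {of_rat a + of_rat b * (\<i> * of_real (sqrt (real_of_int d))) | a b. True}"
    using assms(2) unfolding imag_quad_field_def by blast
  define Z where "Z = (\<lambda>(k, i, j). AA k i j) ` ({..<n} \<times> {..<n} \<times> {..<n})"
  have Z: "finite Z" "Z \<subseteq> F" using assms(4) unfolding Z_def GL_n_over_def by auto
  obtain D where D: "D > 0" and DZ: "\<And>z. z \<in> Z \<Longrightarrow> of_int D * z \<in> quad_order d"
    and DX: "\<And>x i. x \<in> ?X \<Longrightarrow> i < n \<Longrightarrow> of_int D * x i \<in> quad_order d"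
    using shifted_lattice_common_denominator[OF d F _ assms(6) Z] assms(3) by metis
  have A: "of_int D * AA k i j \<in> quad_order d" if "k < n" "i < n" "j < n" for k i j
    using that unfolding Z_def by (intro DZ[unfolded Z_def] image_eqI[of _ _ "(k, i, j)"]) auto
  have det: "det_n n (AA k) \<noteq> 0" if "k < n" for k
    using assms(4) that by (simp add: GL_n_over_def)
  obtain C where C: "C \<ge> 0" "\<And>x. (\<And>i. i < n \<Longrightarrow> of_int D * x i \<in> quad_order d) \<Longrightarrow>
    (\<Sum>i<n. norm (x i)) * norm (psi n AA P x) \<le> C"
    using sum_norm_mult_psi_le[where AA = AA and P = P, OF d D A det] by blast
  obtain c where c: "c > 0" and low: "\<And>x. (\<And>i. i < n \<Longrightarrow> of_int D * x i \<in> quad_order d) \<Longrightarrow>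
    \<exists>i<n. x i \<noteq> 0 \<Longrightarrow> c \<le> (\<Prod>l<n. norm (inner_n n x (Defs.col M l)))"
    using R_n_prod_norm_ge[OF d F assms(7) D] by blast
  obtain C' where C': "C' > 0"
    "\<And>x. (\<Sum>j<n. norm (inner_n n x (Defs.col M j))) \<le> C' * (\<Sum>i<n. norm (x i))"
    using sum_norm_inner_columns_le by blast
  define L where "L = (\<lambda>x i. inner_n n x (Defs.col M i))"
  define w :: "(nat \<Rightarrow> complex) \<Rightarrow> real"
    where "w = (\<lambda>y. 1 / (\<Sum>i<n. norm (y i)) * (1 / (\<Prod>i<n. norm (y i))\<^sup>2))"
  define X0 where "X0 = {x \<in> ?X. \<exists>i<n. x i \<noteq> 0}"
  have sep: "c \<le> (\<Prod>i<n. norm (L x i - L z i))" if xz: "x \<in> ?X" "z \<in> ?X" "x \<noteq> z" for x z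
  proof -
    obtain i where "x i \<noteq> z i" using xz(3) by blast
    \<comment> \<open>Coordinates from \<open>n\<close> on are 0 in \<open>shifted_lattice\<close>,
      so distinct points differ below \<open>n\<close>.\<close>
    then have "\<exists>i<n. x i - z i \<noteq> 0"
      using xz(1,2) unfolding shifted_lattice_def by (cases "i < n") auto
    moreover have "of_int D * (x i - z i) \<in> quad_order d" if i: "i < n" for i
    proof -
      have "of_int D * (x i - z i) = of_int D * x i + of_int (- 1) * (of_int D * z i)"
        by (simp add: algebra_simps)
      also have "\<dots> \<in> quad_order d"
        by (rule quad_order_add[OF d DX[OF xz(1) i] quad_order_mult[OF d of_int_in_quad_order[OF d] DX[OF xz(2) i]]])
      finally show ?thesis .
    qed
    ultimately show ?thesis
      using low[of "\<lambda>i. x i - z i"] by (simp add: inner_n_diff_left L_def)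
  qed
  have inj: "inj_on L X0"
  proof (rule inj_onI, rule ccontr)
    fix x z assume "x \<in> X0" "z \<in> X0" "L x = L z" "x \<noteq> z"
    \<comment> \<open>Equal images make every factor 0; since \<open>n \<ge> 1\<close>, this is not
      the empty product.\<close>
    then have "c \<le> (\<Prod>i<n. 0)" using sep[of x z] by (simp add: X0_def)
    then show False using c assms(1) by (simp add: power_0_left)
  qed
  have lowX: "c \<le> (\<Prod>i<n. norm (L x i))" if "x \<in> X0" for x
    using low[of x] DX that by (simp add: X0_def L_def)
  have "w summable_on L ` X0"
    unfolding w_def
    by (rule summable_on_separated_points[OF assms(1) c]) (use sep lowX in \<open>auto simp: X0_def\<close>)
  then have "(\<lambda>x. w (L x)) summable_on X0"
    using summable_on_reindex[OF inj, of w] by (simp add: o_def)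
  define B where "B = C * C' * c powr (2 + real_of_int k - 2 * Re s)"
  have "(\<lambda>x. B * w (L x)) summable_on X0"
    by (intro summable_on_cmult_right) fact
  then have "(\<lambda>x. norm (psi n AA P x * Omega n s k x M)) summable_on X0"
  proof (rule summable_on_comparison_test)
    fix x assume x: "x \<in> X0"
    let ?S = "\<Sum>i<n. norm (x i)" and ?T = "\<Sum>i<n. norm (L x i)"
    have S: "?S > 0" using x by (auto simp: X0_def sum_pos2)
    have T: "?T > 0"
    proof (rule ccontr)
      assume "\<not> ?thesis"
      then have "?T = 0" by (meson norm_ge_zero sum_nonneg antisym not_le)
      then have "\<forall>i<n. L x i = 0" by (simp add: sum_nonneg_eq_0_iff)
      then have "(\<Prod>i<n. norm (L x i)) = 0" using assms(1) by (intro prod_zero bexI[of _ 0]) auto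
      then show False using lowX[OF x] c by linarith
    qed
    have "?S * norm (psi n AA P x) \<le> C"
      by (rule C(2)) (use DX x in \<open>simp add: X0_def\<close>)
    then have "norm (psi n AA P x) \<le> C / ?S"
      using S by (simp add: pos_le_divide_eq mult.commute)
    also have "\<dots> \<le> C * C' / ?T"
    proof -
      have "C * ?T \<le> C * (C' * ?S)" using C(1) C'(2)[of x] unfolding L_def by (intro mult_left_mono) auto
      then show ?thesis using S T by (simp add: field_simps)
    qed
    finally have psi: "norm (psi n AA P x) \<le> C * C' / ?T" .
    have om: "norm (Omega n s k x M) \<le>
        c powr (2 + real_of_int k - 2 * Re s) * (1 / (\<Prod>i<n. norm (L x i))\<^sup>2)"
      unfolding L_def by (rule norm_Omega_le[OF c _ assms(8)]) (use lowX[OF x] in \<open>simp add: L_def\<close>)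
    have "norm (psi n AA P x * Omega n s k x M) \<le>
        (C * C' / ?T) * (c powr (2 + real_of_int k - 2 * Re s) * (1 / (\<Prod>i<n. norm (L x i))\<^sup>2))"
      unfolding norm_mult using C(1) C'(1) T by (intro mult_mono psi om) auto
    then show "norm (psi n AA P x * Omega n s k x M) \<le> B * w (L x)"
      by (simp add: B_def w_def mult_ac)
  qed simp
  \<comment> \<open>Restoring the zero vector adds only a zero term.\<close>
  also have "?this \<longleftrightarrow> ?thesis"
    by (rule summable_on_cong_neutral) (auto simp: X0_def psi_def)
  finally show ?thesis .
qed

end
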